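(* Let $f=f_{n,q}:[q]^n\to\{0,1\}$ be the element distinctness function. If $q=\Omega(n^2)$, then there exists $\Gamma\in\mathcal{M}$ such that $$\frac{\|\Gamma\|}{\max_{i\in[n]}\|\Gamma\circ\Delta_i\|}=\Omega(n^{2/3}).$$ Explicitly: for every constant $c>0$ there exist a constant $C>0$ and an integer $n_0$ such that for all integers $n\ge n_0$ and all integers $q\ge c\,n^2$ there is a non-zero real matrix $\Gamma\in\mathcal{M}=\mathcal{M}(f_{n,q})$ with $$\frac{\|\Gamma\|}{\max_{i\in[n]}\|\Gamma\circ\Delta_i\|}\ \ge\ C\,n^{2/3}.$$
   Context: For a positive integer $m$, $[m]=\{1,\dots,m\}$. The element distinctness function $f_{n,q}:[q]^n\to\{0,1\}$ evaluates to $0$ on $x=(x_1,\dots,x_n)\in[q]^n$ if the symbols $x_1,\dots,x_n$ are pairwise distinct, and to $1$ otherwise. For $f=f_{n,q}$, $\mathcal{M}=\mathcal{M}(f)$ denotes the set of non-zero real matrices with rows indexed by the elements of $f^{-1}(1)$ and columns indexed by the elements of $f^{-1}(0)$ (entries may be negative). For $i\in[n]$, $\Delta_i$ is the matrix with the same row and column index sets whose entry $(x,y)$ equals $1$ if $x_i\ne y_i$ and $0$ otherwise. $\|\cdot\|$ is the spectral norm (largest singular value), and $\circ$ is the Hadamard (entry-wise) product of matrices. *)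

theory Defs
  imports "HOL-Analysis.Analysis"
begin

(* The elements of [q]^n are the functions from {1..n} to {1..q}, made extensional outside {1..n}
   so that each tuple has exactly one representative. *)
definition strings :: "nat \<Rightarrow> nat \<Rightarrow> (nat \<Rightarrow> nat) set" where
  "strings n q = {1..n} \<rightarrow>\<^sub>E {1..q}"

definition element_distinctness :: "nat \<Rightarrow> (nat \<Rightarrow> nat) \<Rightarrow> nat" where
  "element_distinctness n x = (if inj_on x {1..n} then 0 else 1)"

definition fiber :: "'a set \<Rightarrow> ('a \<Rightarrow> nat) \<Rightarrow> nat \<Rightarrow> 'a set" where
  "fiber D f b = {x \<in> D. f x = b}"

(* A real matrix with finite row index set R and column index set C is a function of two arguments
   that vanishes outside R \<times> C; this makes the representation unique. *)
definition matrices :: "'r set \<Rightarrow> 'c set \<Rightarrow> ('r \<Rightarrow> 'c \<Rightarrow> real) set" where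
  "matrices R C = {A. \<forall>x y. x \<notin> R \<or> y \<notin> C \<longrightarrow> A x y = 0}"

definition hadamard :: "('r \<Rightarrow> 'c \<Rightarrow> real) \<Rightarrow> ('r \<Rightarrow> 'c \<Rightarrow> real) \<Rightarrow> 'r \<Rightarrow> 'c \<Rightarrow> real" where
  "hadamard A B = (\<lambda>x y. A x y * B x y)"

(* The square roots of the eigenvalues of the Gram matrix (transpose of A) * A. If R has fewer
   elements than C, this set may contain 0 in addition to the usual min(|R|,|C|) singular values;
   this does not affect the maximum. Only the entries of v on C are relevant. *)
definition singular_values :: "'r set \<Rightarrow> 'c set \<Rightarrow> ('r \<Rightarrow> 'c \<Rightarrow> real) \<Rightarrow> real set" where
  "singular_values R C A =
     {s. s \<ge> 0 \<and> (\<exists>v. (\<exists>y\<in>C. v y \<noteq> 0) \<and>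
        (\<forall>y\<in>C. (\<Sum>y'\<in>C. (\<Sum>x\<in>R. A x y * A x y') * v y') = s\<^sup>2 * v y))}"

(* For finite R and finite nonempty C the set of singular values is finite and nonempty. *)
definition spectral_norm :: "'r set \<Rightarrow> 'c set \<Rightarrow> ('r \<Rightarrow> 'c \<Rightarrow> real) \<Rightarrow> real" where
  "spectral_norm R C A = Max (singular_values R C A)"

definition adversary_matrices :: "'a set \<Rightarrow> ('a \<Rightarrow> nat) \<Rightarrow> ('a \<Rightarrow> 'a \<Rightarrow> real) set" where
  "adversary_matrices D f = matrices (fiber D f 1) (fiber D f 0) - {\<lambda>x y. 0}"

definition Delta ::
    "(nat \<Rightarrow> 'b) set \<Rightarrow> ((nat \<Rightarrow> 'b) \<Rightarrow> nat) \<Rightarrow> nat \<Rightarrow> (nat \<Rightarrow> 'b) \<Rightarrow> (nat \<Rightarrow> 'b) \<Rightarrow> real" where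
  "Delta D f i = (\<lambda>x y. if x \<in> fiber D f 1 \<and> y \<in> fiber D f 0 \<and> x i \<noteq> y i then 1 else 0)"

definition adversary_norm :: "'a set \<Rightarrow> ('a \<Rightarrow> nat) \<Rightarrow> ('a \<Rightarrow> 'a \<Rightarrow> real) \<Rightarrow> real" where
  "adversary_norm D f A = spectral_norm (fiber D f 1) (fiber D f 0) A"

end

theory Submission
  imports Defs
begin

text \<open>
  The kernels \<open>kern S\<close>, \<open>S \<subseteq> I\<close>, are the orthogonal projections of the space of functions on words onto
  the tensor products in which the coordinates in \<open>S\<close> carry mean-zero functions and the others
  constants. The adversary matrix stacks, for each ordered pair \<open>p\<close> of positions, the operator
  \<open>\<Sum>S. \<alpha> (card S) * kern S\<close> over all \<open>S\<close> not containing both entries of \<open>p\<close>, restricted to the rows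
  colliding at \<open>p\<close> and multiplied by \<open>sqrt q\<close>; this factor makes the restriction isometric on functions that
  do not depend on one of the two positions. Here \<open>\<alpha> k = max 0 (n powr (-1/3) - k/n)\<close>.
  Multiplying entrywise by \<open>x i \<noteq> y i\<close> keeps the operators diagonal in the projections. At pairs avoiding
  \<open>i\<close> only differences of consecutive \<open>\<alpha>\<close> remain, contributing \<open>n\<^sup>2 * (1/n)\<^sup>2\<close>; at pairs
  \<open>(i, b)\<close> a full coefficient remains only if \<open>b \<in> S\<close>, contributing \<open>card S * (\<alpha> (card S))\<^sup>2 \<le> 1\<close>.
  The empty set alone gives a norm of order \<open>n * \<alpha> 0\<close>, and injective words
  form a constant fraction of all words.
\<close>

subsection \<open>The spectral norm\<close>

lemma sum_rotate:
  "(\<Sum>x\<in>A. \<Sum>y\<in>B. \<Sum>z\<in>C. f x y z) = (\<Sum>y\<in>B. \<Sum>z\<in>C. \<Sum>x\<in>A. f x y z)"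
  by (subst sum.swap, intro sum.cong refl, rule sum.swap)

text \<open>Near 0 the linear term dominates. This is the first-order condition that turns a
  maximiser of a quadratic form into an eigenvector.\<close>

lemma quadratic_nonneg_linear_coeff_zero:
  fixes a b :: real
  assumes "\<And>t. a * t\<^sup>2 + b * t \<ge> 0"
  shows "b = 0"
proof (rule ccontr)
  assume b: "b \<noteq> 0"
  \<comment> \<open>\<open>m\<close> is positive and exceeds \<open>a\<close>, so at
    \<open>t = - b / m\<close> the linear term outweighs the quadratic one.\<close>
  define m where "m = \<bar>a\<bar> + 1"
  define t where "t = - b / m"
  have m: "m > 0" "a < m" by (simp_all add: m_def abs_if)
  have "a * t\<^sup>2 + b * t = (b\<^sup>2 / m) * (a / m - 1)"
    using m by (simp add: t_def power2_eq_square field_simps)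
  moreover have "a / m - 1 < 0" using m by simp
  moreover have "b\<^sup>2 / m > 0" using b m by simp
  ultimately have "a * t\<^sup>2 + b * t < 0" by (simp only: mult_pos_neg)
  then show False using assms[of t] by simp
qed

text \<open>The right-hand side is the inner product of \<open>A w\<close> and \<open>A v\<close>:
  symmetric in \<open>w\<close> and \<open>v\<close>, and the squared norm of \<open>A v\<close>
  when \<open>w = v\<close>.\<close>

lemma gram_form:
  fixes A :: "'r \<Rightarrow> 'c \<Rightarrow> real"
  shows "(\<Sum>y\<in>C. w y * (\<Sum>y'\<in>C. (\<Sum>x\<in>R. A x y * A x y') * v y'))
    = (\<Sum>x\<in>R. (\<Sum>y\<in>C. A x y * w y) * (\<Sum>y\<in>C. A x y * v y))"
proof -
  have "(\<Sum>y\<in>C. w y * (\<Sum>y'\<in>C. (\<Sum>x\<in>R. A x y * A x y') * v y'))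
      = (\<Sum>y\<in>C. \<Sum>y'\<in>C. \<Sum>x\<in>R. (A x y * w y) * (A x y' * v y'))"
    by (simp add: sum_distrib_left sum_distrib_right mult_ac)
  also have "\<dots> = (\<Sum>y\<in>C. \<Sum>x\<in>R. \<Sum>y'\<in>C. (A x y * w y) * (A x y' * v y'))"
    by (intro sum.cong refl sum.swap)
  also have "\<dots> = (\<Sum>x\<in>R. \<Sum>y\<in>C. \<Sum>y'\<in>C. (A x y * w y) * (A x y' * v y'))"
    by (rule sum.swap)
  finally show ?thesis by (simp add: sum_product)
qed

section \<open>Largest singular value by compactness\<close>

text \<open>The sphere is a closed subset of a product of intervals \<open>{-1..1}\<close> over
  \<open>C\<close> and points \<open>{0}\<close> elsewhere, compact by Tychonoff. The support
  condition keeps the coordinates outside \<open>C\<close> bounded.\<close>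

lemma compact_unit_sphere_supported:
  fixes C :: "'c set"
  assumes C: "finite C"
  shows "compact {v :: 'c \<Rightarrow> real. (\<forall>y. y \<notin> C \<longrightarrow> v y = 0) \<and> (\<Sum>y\<in>C. (v y)\<^sup>2) = 1}"
proof -
  define B where "B = PiE UNIV (\<lambda>i. if i \<in> C then {-1..1::real} else {0})"
  have "compactin (product_topology (\<lambda>_. euclidean) UNIV) B"
    unfolding B_def by (subst compactin_PiE) auto
  then have B: "compact B" by (simp add: euclidean_product_topology)
  have "closed {v :: 'c \<Rightarrow> real. (\<Sum>y\<in>C. (v y)\<^sup>2) = 1}"
    by (intro closed_Collect_eq continuous_intros continuous_on_product_coordinates)
  with B have "compact (B \<inter> {v :: 'c \<Rightarrow> real. (\<Sum>y\<in>C. (v y)\<^sup>2) = 1})"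
    by (rule compact_Int_closed)
  moreover have "B \<inter> {v :: 'c \<Rightarrow> real. (\<Sum>y\<in>C. (v y)\<^sup>2) = 1}
      = {v :: 'c \<Rightarrow> real. (\<forall>y. y \<notin> C \<longrightarrow> v y = 0) \<and> (\<Sum>y\<in>C. (v y)\<^sup>2) = 1}"
  proof (intro set_eqI iffI)
    fix v assume v: "v \<in> {v :: 'c \<Rightarrow> real. (\<forall>y. y \<notin> C \<longrightarrow> v y = 0) \<and> (\<Sum>y\<in>C. (v y)\<^sup>2) = 1}"
    have "\<bar>v y\<bar> \<le> 1" if "y \<in> C" for y
    proof -
      have "(v y)\<^sup>2 \<le> (\<Sum>y\<in>C. (v y)\<^sup>2)" using C that by (intro member_le_sum) auto
      then show ?thesis using v by (simp add: abs_square_le_1)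
    qed
    then show "v \<in> B \<inter> {v :: 'c \<Rightarrow> real. (\<Sum>y\<in>C. (v y)\<^sup>2) = 1}"
      using v by (auto simp: B_def PiE_def abs_le_iff)
  qed (auto simp: B_def PiE_def split: if_splits)
  ultimately show ?thesis by simp
qed

text \<open>A maximiser \<open>v0\<close> of the quadratic form \<open>Q\<close> on the unit sphere
  is an eigenvector of the Gram matrix with eigenvalue \<open>Q v0\<close>, so
  \<open>sqrt (Q v0)\<close> is a singular value that bounds the whole operator.\<close>

lemma ex_maximal_singular_value:
  fixes A :: "'r \<Rightarrow> 'c \<Rightarrow> real"
  assumes C: "finite C" "C \<noteq> {}"
  shows "\<exists>s \<in> singular_values R C A.
    \<forall>v. (\<Sum>x\<in>R. (\<Sum>y\<in>C. A x y * v y)\<^sup>2) \<le> s\<^sup>2 * (\<Sum>y\<in>C. (v y)\<^sup>2)"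
proof -
  define S where "S = {v. (\<forall>y. y \<notin> C \<longrightarrow> v y = 0) \<and> (\<Sum>y\<in>C. (v y)\<^sup>2) = (1::real)}"
  define Q where "Q v = (\<Sum>x\<in>R. (\<Sum>y\<in>C. A x y * v y)\<^sup>2)" for v
  define N where "N v = (\<Sum>y\<in>C. (v y)\<^sup>2)" for v :: "'c \<Rightarrow> real"
  obtain c where c: "c \<in> C" using C by blast
  have "(\<Sum>y\<in>C. (if y = c then 1 else 0)\<^sup>2) = (1::real)"
    using c C by (simp add: if_distrib[of "\<lambda>t. t\<^sup>2"] cong: if_cong)
  then have ne: "S \<noteq> {}"
    using c unfolding S_def by (intro ex_in_conv[THEN iffD1] exI[of _ "\<lambda>y. if y = c then 1 else 0"]) auto
  have "compact S" unfolding S_def by (rule compact_unit_sphere_supported[OF C(1)])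
  moreover have "continuous_on S Q"
    unfolding Q_def by (intro continuous_intros continuous_on_subset[OF continuous_on_product_coordinates]) auto
  ultimately obtain v0 where v0: "v0 \<in> S" "\<And>v. v \<in> S \<Longrightarrow> Q v \<le> Q v0"
    using continuous_attains_sup[OF _ ne] by metis
  have N0: "N v0 = 1" using v0(1) by (simp add: S_def N_def)
  have Qnn: "Q v \<ge> 0" for v unfolding Q_def by (simp add: sum_nonneg)
  \<comment> \<open>Normalising \<open>v\<close> carries the maximality over from the sphere to all
    vectors.\<close>
  have bound: "Q v \<le> Q v0 * N v" for v
  proof (cases "N v = 0")
    case True
    then have "\<forall>y\<in>C. v y = 0" using C by (simp add: N_def sum_nonneg_eq_0_iff)
    then show ?thesis using True by (simp add: Q_def)
  next
    case False
    have "N v \<ge> 0" by (simp add: N_def sum_nonneg)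
    with False have pos: "N v > 0" by simp
    define u where "u y = (if y \<in> C then v y / sqrt (N v) else 0)" for y
    have "(\<Sum>y\<in>C. (u y)\<^sup>2) = (\<Sum>y\<in>C. (v y)\<^sup>2 / N v)"
      using pos by (intro sum.cong) (auto simp: u_def power_divide)
    also have "\<dots> = 1" using pos by (simp add: sum_divide_distrib[symmetric] N_def)
    finally have "u \<in> S" by (simp add: S_def u_def)
    then have "Q u \<le> Q v0" by (rule v0(2))
    moreover have "Q u = Q v / N v"
    proof -
      have "(\<Sum>y\<in>C. A x y * u y) = (\<Sum>y\<in>C. A x y * v y) / sqrt (N v)" for x
        by (simp add: u_def sum_divide_distrib)
      then have "(\<Sum>y\<in>C. A x y * u y)\<^sup>2 = (\<Sum>y\<in>C. A x y * v y)\<^sup>2 / N v" for x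
        using pos by (simp only: power_divide real_sqrt_pow2 less_imp_le)
      then show ?thesis by (simp add: Q_def sum_divide_distrib)
    qed
    ultimately show ?thesis using pos by (simp add: field_simps)
  qed
  \<comment> \<open>Perturbing \<open>v0\<close> in the coordinate direction \<open>h\<close> turns
    \<open>bound\<close> into a quadratic inequality valid for all \<open>t\<close>. Its constant
    terms cancel because \<open>N v0 = 1\<close>, so its linear coefficient vanishes.\<close>
  have eig: "(\<Sum>y'\<in>C. (\<Sum>x\<in>R. A x y * A x y') * v0 y') = Q v0 * v0 y" if y: "y \<in> C" for y
  proof -
    define h where "h z = (if z = y then 1 else 0 :: real)" for z
    define b where "b = (\<Sum>x\<in>R. (\<Sum>y\<in>C. A x y * h y) * (\<Sum>y\<in>C. A x y * v0 y))"
    have Qe: "Q (\<lambda>z. v0 z + t * h z) = Q v0 + 2 * t * b + t\<^sup>2 * Q h" for t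
    proof -
      have "(\<Sum>y\<in>C. A x y * (v0 y + t * h y)) = (\<Sum>y\<in>C. A x y * v0 y) + t * (\<Sum>y\<in>C. A x y * h y)" for x
        by (simp add: algebra_simps sum.distrib sum_distrib_left)
      then have "Q (\<lambda>z. v0 z + t * h z)
        = (\<Sum>x\<in>R. (\<Sum>y\<in>C. A x y * v0 y)\<^sup>2 + 2 * t * ((\<Sum>y\<in>C. A x y * h y) * (\<Sum>y\<in>C. A x y * v0 y))
              + t\<^sup>2 * (\<Sum>y\<in>C. A x y * h y)\<^sup>2)"
        by (simp add: Q_def power2_eq_square algebra_simps)
      then show ?thesis by (simp add: Q_def b_def sum.distrib sum_distrib_left)
    qed
    have Ne: "N (\<lambda>z. v0 z + t * h z) = 1 + 2 * t * v0 y + t\<^sup>2" for t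
    proof -
      have "N (\<lambda>z. v0 z + t * h z) = N v0 + (\<Sum>z\<in>C. if z = y then 2 * t * v0 y + t\<^sup>2 else 0)"
        unfolding N_def sum.distrib[symmetric]
        by (intro sum.cong) (auto simp: h_def power2_eq_square algebra_simps)
      then show ?thesis using y C N0 by simp
    qed
    have "(Q v0 - Q h) * t\<^sup>2 + (2 * (Q v0 * v0 y - b)) * t \<ge> 0" for t
      using bound[of "\<lambda>z. v0 z + t * h z"] unfolding Qe Ne by (simp add: algebra_simps)
    then have "2 * (Q v0 * v0 y - b) = 0"
      by (rule quadratic_nonneg_linear_coeff_zero)
    moreover have "b = (\<Sum>y'\<in>C. (\<Sum>x\<in>R. A x y * A x y') * v0 y')"
    proof -
      have "b = (\<Sum>z\<in>C. h z * (\<Sum>y'\<in>C. (\<Sum>x\<in>R. A x z * A x y') * v0 y'))"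
        unfolding b_def by (rule gram_form[symmetric])
      also have "\<dots> = (\<Sum>z\<in>C. if z = y then (\<Sum>y'\<in>C. (\<Sum>x\<in>R. A x y * A x y') * v0 y') else 0)"
        by (intro sum.cong) (auto simp: h_def)
      finally show ?thesis using y C by simp
    qed
    ultimately show ?thesis by simp
  qed
  have "\<exists>y\<in>C. v0 y \<noteq> 0"
  proof (rule ccontr)
    assume "\<not> ?thesis"
    then have "N v0 = 0" by (simp add: N_def)
    then show False using N0 by simp
  qed
  then have "sqrt (Q v0) \<in> singular_values R C A"
    using eig Qnn unfolding singular_values_def by auto
  moreover have "Q v \<le> (sqrt (Q v0))\<^sup>2 * N v" for v using bound Qnn by simp
  ultimately show ?thesis unfolding Q_def N_def by blast
qed

section \<open>Finiteness of the set of singular values\<close>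

text \<open>Bessel's inequality for the coordinate vector at \<open>y\<close> bounds the sum of the
  squared entries at \<open>y\<close> by 1; summing over \<open>y \<in> C\<close> counts the
  orthonormal family.\<close>

lemma bessel_card_le:
  fixes v :: "'k \<Rightarrow> 'c \<Rightarrow> real"
  assumes C: "finite C" and K: "finite K"
    and orth: "\<And>j k. j \<in> K \<Longrightarrow> k \<in> K \<Longrightarrow> (\<Sum>y\<in>C. v j y * v k y) = (if j = k then 1 else 0)"
  shows "card K \<le> card C"
proof -
  have le: "(\<Sum>k\<in>K. (v k y)\<^sup>2) \<le> 1" if y: "y \<in> C" for y
  proof -
    define p where "p = (\<Sum>k\<in>K. (v k y)\<^sup>2)"
    define h where "h z = (if z = y then 1 else 0 :: real)" for z
    define g where "g z = (\<Sum>k\<in>K. v k y * v k z)" for z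
    \<comment> \<open>\<open>g\<close> is the projection of \<open>h\<close> on the span of the
      family, and the squared distance expands to \<open>1 - 2 * p + p\<close>.\<close>
    have "0 \<le> (\<Sum>z\<in>C. (h z - g z)\<^sup>2)" by (simp add: sum_nonneg)
    also have "\<dots> = (\<Sum>z\<in>C. (if z = y then 1 - 2 * g y else 0)) + (\<Sum>z\<in>C. g z * g z)"
      unfolding sum.distrib[symmetric]
      by (intro sum.cong) (auto simp: h_def power2_eq_square algebra_simps)
    also have "(\<Sum>z\<in>C. (if z = y then 1 - 2 * g y else 0)) = 1 - 2 * p"
      using y C by (simp add: g_def p_def power2_eq_square)
    also have "(\<Sum>z\<in>C. g z * g z) = (\<Sum>z\<in>C. \<Sum>j\<in>K. \<Sum>k\<in>K. (v j y * v k y) * (v j z * v k z))"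
      by (simp add: g_def sum_product mult_ac)
    also have "\<dots> = (\<Sum>j\<in>K. \<Sum>k\<in>K. (v j y * v k y) * (\<Sum>z\<in>C. v j z * v k z))"
      unfolding sum_distrib_left by (rule sum_rotate)
    also have "\<dots> = (\<Sum>j\<in>K. \<Sum>k\<in>K. if k = j then (v j y)\<^sup>2 else 0)"
      by (intro sum.cong) (auto simp: orth power2_eq_square)
    also have "\<dots> = p" using K by (simp add: p_def)
    finally show ?thesis by (simp add: p_def)
  qed
  have "real (card K) = (\<Sum>k\<in>K. \<Sum>y\<in>C. (v k y)\<^sup>2)"
    using orth by (simp add: power2_eq_square)
  also have "\<dots> = (\<Sum>y\<in>C. \<Sum>k\<in>K. (v k y)\<^sup>2)" by (rule sum.swap)
  also have "\<dots> \<le> (\<Sum>y\<in>C. 1)" by (intro sum_mono le)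
  finally show ?thesis by simp
qed

text \<open>Eigenvectors of the symmetric Gram matrix for distinct eigenvalues are orthogonal, so
  more than \<open>card C\<close> singular values would contradict \<open>bessel_card_le\<close>.
  Finiteness gives \<open>Max\<close> in \<open>spectral_norm\<close> its meaning.\<close>

lemma finite_singular_values:
  fixes A :: "'r \<Rightarrow> 'c \<Rightarrow> real"
  assumes C: "finite C"
  shows "finite (singular_values R C A)"
proof (rule ccontr)
  assume "infinite (singular_values R C A)"
  then obtain K where K: "K \<subseteq> singular_values R C A" "finite K" "card K = Suc (card C)"
    using infinite_arbitrarily_large by blast
  define G where "G y y' = (\<Sum>x\<in>R. A x y * A x y')" for y y'
  have "\<forall>s\<in>K. \<exists>v. (\<exists>y\<in>C. v y \<noteq> 0) \<and> (\<forall>y\<in>C. (\<Sum>y'\<in>C. G y y' * v y') = s\<^sup>2 * v y)"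
    using K(1) unfolding singular_values_def G_def by blast
  then obtain w where w: "\<And>s. s \<in> K \<Longrightarrow> \<exists>y\<in>C. w s y \<noteq> 0"
      "\<And>s y. s \<in> K \<Longrightarrow> y \<in> C \<Longrightarrow> (\<Sum>y'\<in>C. G y y' * w s y') = s\<^sup>2 * w s y"
    by metis
  define N where "N s = (\<Sum>y\<in>C. (w s y)\<^sup>2)" for s
  have N: "N s > 0" if "s \<in> K" for s
    using w(1)[OF that] C unfolding N_def by (meson sum_pos2 zero_less_power2 zero_le_power2)
  define v where "v s y = w s y / sqrt (N s)" for s y
  have "card K \<le> card C"
  proof (rule bessel_card_le[OF C K(2)])
    fix j k assume jk: "j \<in> K" "k \<in> K"
    have *: "(\<Sum>y\<in>C. v j y * v k y) = (\<Sum>y\<in>C. w j y * w k y) / (sqrt (N j) * sqrt (N k))"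
      by (simp add: v_def sum_divide_distrib)
    show "(\<Sum>y\<in>C. v j y * v k y) = (if j = k then 1 else 0)"
    proof (cases "j = k")
      case True
      then show ?thesis using * N[OF jk(2)] by (simp add: N_def power2_eq_square)
    next
      case False
      \<comment> \<open>The symmetric Gram form, evaluated through either eigenvector, scales their
        inner product by the square of \<open>j\<close> and by that of \<open>k\<close>.\<close>
      have "j\<^sup>2 * (\<Sum>y\<in>C. w k y * w j y) = (\<Sum>y\<in>C. w k y * (\<Sum>y'\<in>C. G y y' * w j y'))"
        using w(2) jk by (simp add: sum_distrib_left mult_ac)
      also have "\<dots> = (\<Sum>y\<in>C. w j y * (\<Sum>y'\<in>C. G y y' * w k y'))"
        unfolding G_def gram_form by (simp add: mult.commute)
      also have "\<dots> = k\<^sup>2 * (\<Sum>y\<in>C. w k y * w j y)"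
        using w(2) jk by (simp add: sum_distrib_left mult_ac)
      finally have "(j\<^sup>2 - k\<^sup>2) * (\<Sum>y\<in>C. w k y * w j y) = 0" by (simp add: algebra_simps)
      moreover have "j\<^sup>2 \<noteq> k\<^sup>2"
      proof -
        have "j \<ge> 0" "k \<ge> 0" using jk K(1) by (auto simp: singular_values_def)
        then show ?thesis using False by (simp add: power2_eq_iff_nonneg)
      qed
      ultimately have "(\<Sum>y\<in>C. w k y * w j y) = 0" by simp
      then show ?thesis using * False by (simp add: mult.commute)
    qed
  qed
  then show False using K(3) by simp
qed

section \<open>The spectral norm as an operator norm\<close>

text \<open>An eigenvector for \<open>s\<close> is stretched by \<open>A\<close> by exactly the
  factor \<open>s\<close>, so an operator bound limits every singular value.\<close>

lemma spectral_norm_le: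
  fixes A :: "'r \<Rightarrow> 'c \<Rightarrow> real"
  assumes C: "finite C" "C \<noteq> {}" and B: "B \<ge> 0"
    and bound: "\<And>v. (\<Sum>x\<in>R. (\<Sum>y\<in>C. A x y * v y)\<^sup>2) \<le> B\<^sup>2 * (\<Sum>y\<in>C. (v y)\<^sup>2)"
  shows "spectral_norm R C A \<le> B"
proof -
  have "s \<le> B" if s: "s \<in> singular_values R C A" for s
  proof -
    from s obtain v where v: "\<exists>y\<in>C. v y \<noteq> 0" and s0: "s \<ge> 0"
      and e: "\<And>y. y \<in> C \<Longrightarrow> (\<Sum>y'\<in>C. (\<Sum>x\<in>R. A x y * A x y') * v y') = s\<^sup>2 * v y"
      unfolding singular_values_def by blast
    have pos: "(\<Sum>y\<in>C. (v y)\<^sup>2) > 0"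
      using v C by (meson sum_pos2 zero_less_power2 zero_le_power2)
    have "s\<^sup>2 * (\<Sum>y\<in>C. (v y)\<^sup>2) = (\<Sum>y\<in>C. v y * (\<Sum>y'\<in>C. (\<Sum>x\<in>R. A x y * A x y') * v y'))"
    proof -
      have "(\<Sum>y\<in>C. v y * (\<Sum>y'\<in>C. (\<Sum>x\<in>R. A x y * A x y') * v y')) = (\<Sum>y\<in>C. v y * (s\<^sup>2 * v y))"
        by (intro sum.cong refl) (simp only: e)
      then show ?thesis by (simp add: sum_distrib_left power2_eq_square mult_ac)
    qed
    also have "\<dots> \<le> B\<^sup>2 * (\<Sum>y\<in>C. (v y)\<^sup>2)"
      using bound[of v] unfolding gram_form by (simp add: power2_eq_square)
    finally have "s\<^sup>2 \<le> B\<^sup>2" using pos by simp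
    then show ?thesis using B by (rule power2_le_imp_le)
  qed
  moreover have "singular_values R C A \<noteq> {}" using ex_maximal_singular_value[OF C] by blast
  ultimately show ?thesis
    unfolding spectral_norm_def by (simp add: finite_singular_values[OF C(1)])
qed

text \<open>The maximum dominates the singular value from \<open>ex_maximal_singular_value\<close>,
  which bounds \<open>A v\<close>; Cauchy-Schwarz handles \<open>u\<close>. Lower bounds on the norm
  come from choosing test vectors \<open>u\<close> and \<open>v\<close>.\<close>

lemma bilinear_form_le_spectral_norm:
  fixes A :: "'r \<Rightarrow> 'c \<Rightarrow> real"
  assumes C: "finite C" "C \<noteq> {}"
  shows "(\<Sum>x\<in>R. u x * (\<Sum>y\<in>C. A x y * v y))
    \<le> sqrt (\<Sum>x\<in>R. (u x)\<^sup>2) * spectral_norm R C A * sqrt (\<Sum>y\<in>C. (v y)\<^sup>2)"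
    and "spectral_norm R C A \<ge> 0"
proof -
  obtain s where s: "s \<in> singular_values R C A"
    "\<And>v. (\<Sum>x\<in>R. (\<Sum>y\<in>C. A x y * v y)\<^sup>2) \<le> s\<^sup>2 * (\<Sum>y\<in>C. (v y)\<^sup>2)"
    using ex_maximal_singular_value[OF C] by blast
  have s0: "s \<ge> 0" using s(1) by (simp add: singular_values_def)
  have sM: "s \<le> spectral_norm R C A"
    unfolding spectral_norm_def using s(1) finite_singular_values[OF C(1)] by (rule Max_ge[rotated])
  show nn: "spectral_norm R C A \<ge> 0" using s0 sM by simp
  have "sqrt (\<Sum>x\<in>R. (\<Sum>y\<in>C. A x y * v y)\<^sup>2) \<le> sqrt (s\<^sup>2 * (\<Sum>y\<in>C. (v y)\<^sup>2))"
    using s(2) by simp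
  also have "\<dots> = s * sqrt (\<Sum>y\<in>C. (v y)\<^sup>2)" using s0 by (simp add: real_sqrt_mult)
  also have "\<dots> \<le> spectral_norm R C A * sqrt (\<Sum>y\<in>C. (v y)\<^sup>2)"
    using sM by (intro mult_right_mono) (auto intro: sum_nonneg)
  finally have 1: "sqrt (\<Sum>x\<in>R. (\<Sum>y\<in>C. A x y * v y)\<^sup>2) \<le> \<dots>" .
  have "(\<Sum>x\<in>R. u x * (\<Sum>y\<in>C. A x y * v y))
      \<le> (\<Sum>x\<in>R. \<bar>u x\<bar> * \<bar>\<Sum>y\<in>C. A x y * v y\<bar>)"
    by (intro sum_mono) (metis abs_ge_self abs_mult)
  also have "\<dots> \<le> sqrt (\<Sum>x\<in>R. (u x)\<^sup>2) * sqrt (\<Sum>x\<in>R. (\<Sum>y\<in>C. A x y * v y)\<^sup>2)"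
    using L2_set_mult_ineq[where A = R and f = u and g = "\<lambda>x. \<Sum>y\<in>C. A x y * v y"] by (simp add: L2_set_def)
  also have "\<dots> \<le> sqrt (\<Sum>x\<in>R. (u x)\<^sup>2) * (spectral_norm R C A * sqrt (\<Sum>y\<in>C. (v y)\<^sup>2))"
    using 1 by (intro mult_left_mono) (auto intro: sum_nonneg)
  finally show "(\<Sum>x\<in>R. u x * (\<Sum>y\<in>C. A x y * v y))
    \<le> sqrt (\<Sum>x\<in>R. (u x)\<^sup>2) * spectral_norm R C A * sqrt (\<Sum>y\<in>C. (v y)\<^sup>2)"
    by (simp add: mult.assoc)
qed

text \<open>Coordinate test vectors, with \<open>u\<close> scaled by the entry, give the bilinear
  form the value \<open>A x y * A x y\<close>.\<close>

lemma spectral_norm_pos: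
  fixes A :: "'r \<Rightarrow> 'c \<Rightarrow> real"
  assumes R: "finite R" and C: "finite C" and xy: "x \<in> R" "y \<in> C" "A x y \<noteq> 0"
  shows "spectral_norm R C A > 0"
proof -
  define u where "u x' = (if x' = x then A x y else 0)" for x'
  define v where "v y' = (if y' = y then 1 else 0 :: real)" for y'
  have "(\<Sum>y'\<in>C. A x' y' * v y') = A x' y" for x'
    using xy C by (simp add: v_def if_distrib[of "\<lambda>t. _ * t"] cong: if_cong)
  then have "(\<Sum>x'\<in>R. u x' * (\<Sum>y'\<in>C. A x' y' * v y')) = (\<Sum>x'\<in>R. if x' = x then A x y * A x y else 0)"
    by (auto simp: u_def intro: sum.cong)
  also have "\<dots> = A x y * A x y" using R xy by simp
  finally have eq: "(\<Sum>x'\<in>R. u x' * (\<Sum>y'\<in>C. A x' y' * v y')) = A x y * A x y" .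
  have ne: "C \<noteq> {}" using xy by blast
  have "A x y * A x y
      \<le> sqrt (\<Sum>x'\<in>R. (u x')\<^sup>2) * spectral_norm R C A * sqrt (\<Sum>y'\<in>C. (v y')\<^sup>2)"
    unfolding eq[symmetric] by (rule bilinear_form_le_spectral_norm(1)[OF C ne])
  moreover have "A x y * A x y > 0" using xy by (simp add: zero_less_mult_iff linorder_neq_iff[symmetric])
  ultimately have "spectral_norm R C A \<noteq> 0" by auto
  then show ?thesis using bilinear_form_le_spectral_norm(2)[OF C ne, where R = R and A = A] by simp
qed

subsection \<open>Projections on functions of words\<close>

locale word_space =
  fixes I :: "'i set" and Q :: "'s set"
  assumes finite_I: "finite I" and finite_Q: "finite Q" and Q_nonempty: "Q \<noteq> {}"
begin

abbreviation \<Omega> :: "('i \<Rightarrow> 's) set" where "\<Omega> \<equiv> I \<rightarrow>\<^sub>E Q"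

abbreviation q :: real where "q \<equiv> real (card Q)"

text \<open>On functions of one letter, \<open>factor False\<close> is averaging, the orthogonal
  projection on constants, and \<open>factor True\<close> is the complementary projection on
  mean-zero functions.\<close>

definition factor :: "bool \<Rightarrow> 's \<Rightarrow> 's \<Rightarrow> real" where
  "factor s u v = (if s then (if u = v then 1 else 0) - 1 / q else 1 / q)"

definition kern :: "'i set \<Rightarrow> ('i \<Rightarrow> 's) \<Rightarrow> ('i \<Rightarrow> 's) \<Rightarrow> real" where
  "kern S x y = (\<Prod>i\<in>I. factor (i \<in> S) (x i) (y i))"

text \<open>The operator diagonal in the projections \<open>kern S\<close>, with eigenvalue
  \<open>c S\<close> on the range of \<open>kern S\<close>.\<close>

definition multiplier :: "('i set \<Rightarrow> real) \<Rightarrow> ('i \<Rightarrow> 's) \<Rightarrow> ('i \<Rightarrow> 's) \<Rightarrow> real" where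
  "multiplier c x y = (\<Sum>S\<in>Pow I. c S * kern S x y)"

definition energy :: "('i \<Rightarrow> 's) set \<Rightarrow> (('i \<Rightarrow> 's) \<Rightarrow> ('i \<Rightarrow> 's) \<Rightarrow> real) \<Rightarrow> (('i \<Rightarrow> 's) \<Rightarrow> real) \<Rightarrow> real"
  where "energy X K w = (\<Sum>x\<in>X. (\<Sum>y\<in>\<Omega>. K x y * w y)\<^sup>2)"

lemma q_pos: "q > 0"
  using finite_Q Q_nonempty by (simp add: card_gt_0_iff)

lemma q_ge_1: "q \<ge> 1"
  using finite_Q Q_nonempty by (simp add: Suc_le_eq card_gt_0_iff)

lemma finite_\<Omega>: "finite \<Omega>"
  using finite_I finite_Q by (simp add: finite_PiE)

lemma \<Omega>_upd: "x \<in> \<Omega> \<Longrightarrow> a \<in> I \<Longrightarrow> u \<in> Q \<Longrightarrow> x(a := u) \<in> \<Omega>"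
  by (auto simp: PiE_iff extensional_def)

lemma factor_sym: "factor s u v = factor s v u"
  by (auto simp: factor_def)

lemma kern_sym: "kern S x y = kern S y x"
  by (simp add: kern_def factor_sym)

lemma sum_factor: "v \<in> Q \<Longrightarrow> (\<Sum>u\<in>Q. factor s u v) = (if s then 0 else 1)"
  using Q_nonempty finite_Q by (simp add: factor_def sum_subtractf)

lemma factor_comp:
  assumes "u \<in> Q" "v \<in> Q"
  shows "(\<Sum>t\<in>Q. factor s u t * factor s' t v) = (if s = s' then factor s u v else 0)"
proof (cases s)
  case True
  have "(\<Sum>t\<in>Q. factor s u t * factor s' t v)
      = (\<Sum>t\<in>Q. (if t = u then factor s' u v else 0) - factor s' t v / q)"
    using True by (intro sum.cong) (auto simp: factor_def[of True] algebra_simps)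
  also have "\<dots> = factor s' u v - (if s' then 0 else 1) / q"
    using assms finite_Q by (simp add: sum_subtractf sum_divide_distrib[symmetric] sum_factor)
  finally show ?thesis using True by (auto simp: factor_def)
next
  case False
  then have "factor s u t = 1 / q" for t by (simp add: factor_def)
  then have "(\<Sum>t\<in>Q. factor s u t * factor s' t v) = (\<Sum>t\<in>Q. factor s' t v) / q"
    by (simp add: sum_divide_distrib)
  then show ?thesis using assms False by (simp add: sum_factor) (simp add: factor_def)
qed

text \<open>The sum over words factors into one sum per coordinate, each evaluated by
  \<open>factor_comp\<close>; a coordinate in exactly one of \<open>S\<close> and \<open>T\<close>
  makes the product vanish.\<close>

lemma kern_comp:
  assumes xy: "x \<in> \<Omega>" "y \<in> \<Omega>" and ST: "S \<subseteq> I" "T \<subseteq> I"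
  shows "(\<Sum>z\<in>\<Omega>. kern S x z * kern T z y) = (if S = T then kern S x y else 0)"
proof -
  have "(\<Sum>z\<in>\<Omega>. kern S x z * kern T z y)
      = (\<Sum>z\<in>\<Omega>. \<Prod>i\<in>I. factor (i \<in> S) (x i) (z i) * factor (i \<in> T) (z i) (y i))"
    by (simp add: kern_def prod.distrib)
  also have "\<dots> = (\<Prod>i\<in>I. \<Sum>t\<in>Q. factor (i \<in> S) (x i) t * factor (i \<in> T) t (y i))"
    using finite_I finite_Q by (intro prod_sum_PiE[symmetric]) auto
  also have "\<dots> = (\<Prod>i\<in>I. if (i \<in> S) = (i \<in> T) then factor (i \<in> S) (x i) (y i) else 0)"
    using xy by (intro prod.cong refl factor_comp) (auto simp: PiE_iff)
  also have "\<dots> = (if S = T then kern S x y else 0)"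
  proof (cases "S = T")
    case False
    then obtain i where "i \<in> I" "(i \<in> S) \<noteq> (i \<in> T)" using ST by blast
    then have "(\<Prod>i\<in>I. if (i \<in> S) = (i \<in> T) then factor (i \<in> S) (x i) (y i) else 0) = 0"
      using finite_I by (intro prod_zero) auto
    then show ?thesis using False by simp
  qed (simp add: kern_def)
  finally show ?thesis .
qed

text \<open>A single coordinate in \<open>S\<close> contributes a mean-zero factor, which
  annihilates the column sum. Hence the all-ones test vector sees \<open>kern {}\<close>
  alone.\<close>

lemma sum_kern:
  assumes "y \<in> \<Omega>" "S \<subseteq> I"
  shows "(\<Sum>x\<in>\<Omega>. kern S x y) = (if S = {} then 1 else 0)"
proof -
  have "(\<Sum>x\<in>\<Omega>. kern S x y) = (\<Prod>i\<in>I. \<Sum>t\<in>Q. factor (i \<in> S) t (y i))"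
    unfolding kern_def using finite_I finite_Q by (intro prod_sum_PiE[symmetric]) auto
  also have "\<dots> = (\<Prod>i\<in>I. if i \<in> S then 0 else 1)"
    using assms by (intro prod.cong refl sum_factor) (auto simp: PiE_iff)
  also have "\<dots> = (if S = {} then 1 else 0)"
    using assms finite_I by (auto intro!: prod_zero)
  finally show ?thesis .
qed

text \<open>Expanding the product over the coordinates of \<open>factor True + factor False\<close>,
  which is the identity, gives one term per subset: the projections resolve the identity.\<close>

lemma multiplier_const_1:
  assumes "x \<in> \<Omega>" "y \<in> \<Omega>"
  shows "multiplier (\<lambda>S. 1) x y = (if x = y then 1 else 0)"
proof -
  have "kern S x y = (\<Prod>i\<in>S. factor True (x i) (y i)) * (\<Prod>i\<in>I-S. factor False (x i) (y i))"
    if "S \<in> Pow I" for S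
  proof -
    have "kern S x y = (\<Prod>i\<in>I-S. factor (i \<in> S) (x i) (y i)) * (\<Prod>i\<in>S. factor (i \<in> S) (x i) (y i))"
      unfolding kern_def using that finite_I by (intro prod.subset_diff) auto
    then show ?thesis by (simp add: mult.commute)
  qed
  then have "multiplier (\<lambda>S. 1) x y = (\<Prod>i\<in>I. factor True (x i) (y i) + factor False (x i) (y i))"
    unfolding multiplier_def by (simp add: prod_add[OF finite_I])
  also have "\<dots> = (\<Prod>i\<in>I. if x i = y i then 1 else 0)"
    by (simp add: factor_def cong: prod.cong)
  also have "\<dots> = (if x = y then 1 else 0)"
  proof (cases "x = y")
    case False
    then obtain i where "i \<in> I" "x i \<noteq> y i" using assms by (metis PiE_ext)
    then have "(\<Prod>i\<in>I. if x i = y i then 1 else (0::real)) = 0" using finite_I by (intro prod_zero) auto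
    then show ?thesis using False by simp
  qed simp
  finally show ?thesis .
qed

lemma multiplier_add:
  "multiplier (\<lambda>S. c S + d S) x y = multiplier c x y + multiplier d x y"
  by (simp add: multiplier_def algebra_simps sum.distrib)

lemma energy_nonneg: "energy X K w \<ge> 0"
  by (simp add: energy_def sum_nonneg)

lemma kern_orthogonal:
  assumes ST: "S \<subseteq> I" "T \<subseteq> I" "S \<noteq> T"
  shows "(\<Sum>x\<in>\<Omega>. (\<Sum>y\<in>\<Omega>. kern S x y * w y) * (\<Sum>y\<in>\<Omega>. kern T x y * w y)) = 0"
proof -
  have "(\<Sum>x\<in>\<Omega>. (\<Sum>y\<in>\<Omega>. kern S x y * w y) * (\<Sum>y\<in>\<Omega>. kern T x y * w y))
      = (\<Sum>x\<in>\<Omega>. \<Sum>y\<in>\<Omega>. \<Sum>z\<in>\<Omega>. w y * w z * (kern S y x * kern T x z))"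
    by (simp add: sum_product kern_sym[of S] mult_ac)
  also have "\<dots> = (\<Sum>y\<in>\<Omega>. \<Sum>z\<in>\<Omega>. w y * w z * (\<Sum>x\<in>\<Omega>. kern S y x * kern T x z))"
    unfolding sum_distrib_left by (rule sum_rotate)
  also have "\<dots> = 0" using ST by (simp add: kern_comp)
  finally show ?thesis .
qed

text \<open>Pythagoras: cross terms between different projections vanish by
  \<open>kern_orthogonal\<close>.\<close>

lemma energy_multiplier:
  "energy \<Omega> (multiplier c) w = (\<Sum>S\<in>Pow I. (c S)\<^sup>2 * energy \<Omega> (kern S) w)"
proof -
  define g where "g S x = (\<Sum>y\<in>\<Omega>. kern S x y * w y)" for S x
  have M: "(\<Sum>y\<in>\<Omega>. multiplier c x y * w y) = (\<Sum>S\<in>Pow I. c S * g S x)" for x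
    unfolding multiplier_def g_def sum_distrib_left sum_distrib_right
    by (subst sum.swap) (simp add: mult_ac)
  have "energy \<Omega> (multiplier c) w
      = (\<Sum>x\<in>\<Omega>. \<Sum>S\<in>Pow I. \<Sum>T\<in>Pow I. c S * c T * (g S x * g T x))"
    unfolding energy_def M by (simp add: power2_eq_square sum_product mult_ac)
  also have "\<dots> = (\<Sum>S\<in>Pow I. \<Sum>T\<in>Pow I. c S * c T * (\<Sum>x\<in>\<Omega>. g S x * g T x))"
    unfolding sum_distrib_left by (rule sum_rotate)
  also have "\<dots> = (\<Sum>S\<in>Pow I. \<Sum>T\<in>Pow I. if T = S then (c S)\<^sup>2 * energy \<Omega> (kern S) w else 0)"
    by (intro sum.cong refl) (auto simp: g_def kern_orthogonal energy_def power2_eq_square)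
  finally show ?thesis using finite_I by simp
qed

lemma parseval: "(\<Sum>S\<in>Pow I. energy \<Omega> (kern S) w) = (\<Sum>x\<in>\<Omega>. (w x)\<^sup>2)"
proof -
  have "(\<Sum>y\<in>\<Omega>. multiplier (\<lambda>S. 1) x y * w y) = w x" if "x \<in> \<Omega>" for x
  proof -
    have "(\<Sum>y\<in>\<Omega>. multiplier (\<lambda>S. 1) x y * w y) = (\<Sum>y\<in>\<Omega>. if y = x then w x else 0)"
      using that by (intro sum.cong) (auto simp: multiplier_const_1)
    then show ?thesis using that finite_\<Omega> by simp
  qed
  then have "energy \<Omega> (multiplier (\<lambda>S. 1)) w = (\<Sum>x\<in>\<Omega>. (w x)\<^sup>2)" by (simp add: energy_def)
  then show ?thesis by (simp add: energy_multiplier)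
qed

section \<open>Restriction to the words colliding at a pair\<close>

text \<open>Overwriting letter \<open>a\<close> by letter \<open>b\<close> while remembering the old
  letter is a bijection from all words to pairs of a colliding word and a free letter. As
  \<open>g\<close> is blind to letter \<open>a\<close>, each colliding word is counted
  \<open>q\<close> times.\<close>

lemma sum_collision:
  assumes ab: "a \<in> I" "b \<in> I" "a \<noteq> b"
    and inv: "\<And>x u. x \<in> \<Omega> \<Longrightarrow> u \<in> Q \<Longrightarrow> g (x(a := u)) = g x"
  shows "q * (\<Sum>x | x \<in> \<Omega> \<and> x a = x b. g x) = (\<Sum>x\<in>\<Omega>. g x :: real)"
proof -
  have "(\<Sum>x\<in>\<Omega>. g x) = (\<Sum>(x, u)\<in>{x \<in> \<Omega>. x a = x b} \<times> Q. g x)"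
  proof (rule sum.reindex_bij_witness[where j = "\<lambda>y. (y(a := y b), y a)" and i = "\<lambda>(x, u). x(a := u)"])
    fix y assume y: "y \<in> \<Omega>"
    show "(case (y(a := y b), y a) of (x, u) \<Rightarrow> x(a := u)) = y" by simp
    show "(y(a := y b), y a) \<in> {x \<in> \<Omega>. x a = x b} \<times> Q"
      using y ab \<Omega>_upd[OF y ab(1), of "y b"] by (auto simp: PiE_iff)
    show "(case (y(a := y b), y a) of (x, u) \<Rightarrow> g x) = g y"
      using y ab inv[OF y, of "y b"] by (auto simp: PiE_iff)
  next
    fix p assume p: "p \<in> {x \<in> \<Omega>. x a = x b} \<times> Q"
    obtain x u where xu: "p = (x, u)" by (cases p)
    show "(case p of (x, u) \<Rightarrow> x(a := u)) \<in> \<Omega>"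
      using p \<Omega>_upd ab(1) by (auto simp: xu)
    have "x(a := x b) = x" using p by (auto simp: xu fun_upd_idem)
    then show "((case p of (x, u) \<Rightarrow> x(a := u))(a := (case p of (x, u) \<Rightarrow> x(a := u)) b),
        (case p of (x, u) \<Rightarrow> x(a := u)) a) = p"
      using ab by (simp add: xu)
  qed
  also have "\<dots> = (\<Sum>x | x \<in> \<Omega> \<and> x a = x b. \<Sum>u\<in>Q. g x)"
    by (rule sum.cartesian_product[symmetric])
  also have "\<dots> = q * (\<Sum>x | x \<in> \<Omega> \<and> x a = x b. g x)"
    by (simp add: sum_distrib_left)
  finally show ?thesis by simp
qed

lemma kern_upd: "a \<notin> S \<Longrightarrow> kern S (x(a := u)) y = kern S x y"
  unfolding kern_def by (intro prod.cong) (auto simp: factor_def)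

lemma multiplier_upd:
  assumes "\<And>S. a \<in> S \<Longrightarrow> c S = 0"
  shows "multiplier c (x(a := u)) y = multiplier c x y"
  unfolding multiplier_def using assms by (intro sum.cong refl) (metis kern_upd mult_zero_left)

text \<open>The rows do not depend on letter \<open>a\<close>, so \<open>sum_collision\<close>
  applies to their squares: scaled by \<open>sqrt q\<close>, the restriction is isometric.\<close>

lemma energy_collision:
  assumes ab: "a \<in> I" "b \<in> I" "a \<noteq> b" and c: "\<And>S. a \<in> S \<Longrightarrow> c S = 0"
  shows "q * energy {x \<in> \<Omega>. x a = x b} (multiplier c) w = energy \<Omega> (multiplier c) w"
  unfolding energy_def
  by (rule sum_collision[OF ab]) (simp add: multiplier_upd[OF c])

text \<open>The sets \<open>S\<close> are split by which of \<open>a\<close> and \<open>b\<close>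
  they contain. Those missing one of them restrict isometrically; for those with both, the
  restriction is simply dropped, at the cost of the weight \<open>q\<close>. The factor 3 comes from
  squaring a sum of three parts.\<close>

lemma energy_collision_le:
  assumes ab: "a \<in> I" "b \<in> I" "a \<noteq> b"
  shows "q * energy {x \<in> \<Omega>. x a = x b} (multiplier c) w
    \<le> 3 * (\<Sum>S\<in>Pow I. (if a \<in> S \<and> b \<in> S then q else 1) * (c S)\<^sup>2 * energy \<Omega> (kern S) w)"
proof -
  define c1 where "c1 S = (if a \<in> S then 0 else c S)" for S
  define c2 where "c2 S = (if a \<in> S \<and> b \<notin> S then c S else 0)" for S
  define c3 where "c3 S = (if a \<in> S \<and> b \<in> S then c S else 0)" for S
  let ?X = "{x \<in> \<Omega>. x a = x b}"
  have "c = (\<lambda>S. c1 S + (c2 S + c3 S))" by (auto simp: c1_def c2_def c3_def)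
  then have M: "multiplier c x y = multiplier c1 x y + (multiplier c2 x y + multiplier c3 x y)" for x y
    using multiplier_add[of c1 "\<lambda>S. c2 S + c3 S" x y] multiplier_add[of c2 c3 x y] by simp
  have sq: "(r + (s + t))\<^sup>2 \<le> 3 * (r\<^sup>2 + s\<^sup>2 + t\<^sup>2)" for r s t :: real
  proof -
    have "3 * (r\<^sup>2 + s\<^sup>2 + t\<^sup>2) - (r + (s + t))\<^sup>2 = (r - s)\<^sup>2 + (s - t)\<^sup>2 + (r - t)\<^sup>2"
      by (simp add: power2_eq_square algebra_simps)
    then show ?thesis by (smt (verit) zero_le_power2)
  qed
  have "energy ?X (multiplier c) w
      \<le> 3 * (energy ?X (multiplier c1) w + energy ?X (multiplier c2) w + energy ?X (multiplier c3) w)"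
  proof -
    have eq: "(\<Sum>y\<in>\<Omega>. multiplier c x y * w y) = (\<Sum>y\<in>\<Omega>. multiplier c1 x y * w y)
        + ((\<Sum>y\<in>\<Omega>. multiplier c2 x y * w y) + (\<Sum>y\<in>\<Omega>. multiplier c3 x y * w y))" for x
      unfolding M distrib_right sum.distrib ..
    show ?thesis
      unfolding energy_def eq unfolding sum.distrib[symmetric, where A = "{x \<in> \<Omega>. x a = x b}"] sum_distrib_left
      by (intro sum_mono sq)
  qed
  then have "q * energy ?X (multiplier c) w
      \<le> q * (3 * (energy ?X (multiplier c1) w + energy ?X (multiplier c2) w + energy ?X (multiplier c3) w))"
    using q_pos by (intro mult_left_mono) auto
  also have "\<dots> = 3 * (q * energy ?X (multiplier c1) w + q * energy ?X (multiplier c2) w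
      + q * energy ?X (multiplier c3) w)"
    by (simp add: algebra_simps)
  also have "q * energy ?X (multiplier c1) w = energy \<Omega> (multiplier c1) w"
    by (rule energy_collision[OF ab]) (simp add: c1_def)
  \<comment> \<open>The roles of \<open>a\<close> and \<open>b\<close> are swapped, since here
    \<open>b\<close> is the missing coordinate.\<close>
  also have "q * energy ?X (multiplier c2) w = energy \<Omega> (multiplier c2) w"
    using energy_collision[OF ab(2,1), of c2 w] ab(3) by (simp add: c2_def eq_commute)
  also have "3 * (energy \<Omega> (multiplier c1) w + energy \<Omega> (multiplier c2) w + q * energy ?X (multiplier c3) w)
      \<le> 3 * (energy \<Omega> (multiplier c1) w + energy \<Omega> (multiplier c2) w + q * energy \<Omega> (multiplier c3) w)"
    unfolding energy_def using finite_\<Omega> q_pos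
    by (intro mult_left_mono add_left_mono sum_mono2) auto
  also have "\<dots> = 3 * (\<Sum>S\<in>Pow I. (if a \<in> S \<and> b \<in> S then q else 1) * (c S)\<^sup>2 * energy \<Omega> (kern S) w)"
    unfolding energy_multiplier sum_distrib_left sum.distrib[symmetric]
    by (intro sum.cong) (auto simp: c1_def c2_def c3_def)
  finally show ?thesis .
qed

text \<open>For \<open>S\<close> missing \<open>a\<close> or \<open>b\<close>, the colliding rows
  carry a \<open>1 / q\<close> share of the full column sum, which vanishes unless \<open>S\<close>
  is empty.\<close>

lemma sum_multiplier_collision:
  assumes ab: "a \<in> I" "b \<in> I" "a \<noteq> b" and y: "y \<in> \<Omega>"
    and c: "\<And>S. a \<in> S \<Longrightarrow> b \<in> S \<Longrightarrow> c S = 0"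
  shows "(\<Sum>x | x \<in> \<Omega> \<and> x a = x b. multiplier c x y) = c {} / q"
proof -
  have *: "q * (\<Sum>x | x \<in> \<Omega> \<and> x a = x b. kern S x y) = (if S = {} then 1 else 0)"
    if S: "S \<subseteq> I" "\<not> (a \<in> S \<and> b \<in> S)" for S
  proof -
    have "q * (\<Sum>x | x \<in> \<Omega> \<and> x a = x b. kern S x y) = (\<Sum>x\<in>\<Omega>. kern S x y)"
    proof (cases "a \<in> S")
      case False
      then show ?thesis using sum_collision[OF ab, of "\<lambda>x. kern S x y"] by (simp add: kern_upd)
    next
      case True
      then have "b \<notin> S" using S by simp
      then show ?thesis using sum_collision[OF ab(2,1), of "\<lambda>x. kern S x y"] ab(3)
        by (simp add: kern_upd eq_commute)
    qed
    then show ?thesis using y S by (simp add: sum_kern)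
  qed
  have "q * (\<Sum>x | x \<in> \<Omega> \<and> x a = x b. multiplier c x y)
      = (\<Sum>S\<in>Pow I. c S * (q * (\<Sum>x | x \<in> \<Omega> \<and> x a = x b. kern S x y)))"
    unfolding multiplier_def sum_distrib_left by (subst sum.swap) (simp add: mult_ac)
  also have "\<dots> = (\<Sum>S\<in>Pow I. if S = {} then c {} else 0)"
  proof (intro sum.cong refl)
    fix S assume "S \<in> Pow I"
    then show "c S * (q * (\<Sum>x | x \<in> \<Omega> \<and> x a = x b. kern S x y)) = (if S = {} then c {} else 0)"
      using *[of S] c[of S] by (cases "a \<in> S \<and> b \<in> S") auto
  qed
  also have "\<dots> = c {}" using finite_I by simp
  finally show ?thesis using q_pos by (simp add: field_simps)
qed

section \<open>Masking by \<open>x i \<noteq> y i\<close>\<close>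

text \<open>In coordinate \<open>i\<close> the mask turns \<open>factor True\<close> and
  \<open>factor False\<close> into \<open>- 1 / q\<close> and \<open>1 / q\<close> times the
  zero-diagonal all-ones matrix, which equals \<open>(q - 1) * factor False - factor True\<close>.
  Collecting terms gives these differences.\<close>

definition hadamard_coeff :: "'i \<Rightarrow> ('i set \<Rightarrow> real) \<Rightarrow> 'i set \<Rightarrow> real" where
  "hadamard_coeff i c S = (if i \<in> S then (c S - c (S - {i})) / q
     else (1 - 1 / q) * (c S - c (insert i S)))"

text \<open>The mask touches coordinate \<open>i\<close> only, and \<open>kern S\<close> and
  \<open>kern (insert i S)\<close> agree in all others, so the identity is checked on each such pair
  of terms.\<close>

lemma multiplier_hadamard:
  assumes i: "i \<in> I"
  shows "multiplier c x y * (if x i \<noteq> y i then 1 else 0) = multiplier (hadamard_coeff i c) x y"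
proof -
  define J where "J = I - {i}"
  have J: "finite J" "i \<notin> J" "I = insert i J" using finite_I i by (auto simp: J_def)
  define r where "r S = (\<Prod>j\<in>J. factor (j \<in> S) (x j) (y j))" for S
  have k: "kern S x y = factor (i \<in> S) (x i) (y i) * r S" for S
    unfolding kern_def r_def using J by simp
  have r: "r (insert i S) = r S" for S
    unfolding r_def
  proof (intro prod.cong refl)
    fix j assume "j \<in> J"
    then have "(j \<in> insert i S) = (j \<in> S)" using J(2) by auto
    then show "factor (j \<in> insert i S) (x j) (y j) = factor (j \<in> S) (x j) (y j)" by simp
  qed
  have split: "(\<Sum>S\<in>Pow I. f S) = (\<Sum>S\<in>Pow J. f S + f (insert i S))" for f :: "'i set \<Rightarrow> real"
  proof -
    have "(\<Sum>S\<in>Pow I. f S) = (\<Sum>S\<in>Pow J. f S) + (\<Sum>S\<in>insert i ` Pow J. f S)"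
      unfolding J(3) Pow_insert using J by (intro sum.union_disjoint) auto
    also have "(\<Sum>S\<in>insert i ` Pow J. f S) = (\<Sum>S\<in>Pow J. f (insert i S))"
    proof -
      have "inj_on (insert i) (Pow J)" using J by (auto simp: inj_on_def)
      then show ?thesis by (simp add: sum.reindex)
    qed
    finally show ?thesis by (simp add: sum.distrib)
  qed
  show ?thesis
    unfolding multiplier_def split sum_distrib_right
  proof (intro sum.cong refl)
    fix S assume "S \<in> Pow J"
    then have "i \<notin> S" "insert i S - {i} = S" using J by auto
    then show "(c S * kern S x y + c (insert i S) * kern (insert i S) x y) * (if x i \<noteq> y i then 1 else 0)
        = hadamard_coeff i c S * kern S x y + hadamard_coeff i c (insert i S) * kern (insert i S) x y"
      using q_pos by (simp add: hadamard_coeff_def k r factor_def field_simps)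
  qed
qed

subsection \<open>The collision matrix\<close>

definition pairs :: "('i \<times> 'i) set" where
  "pairs = {p \<in> I \<times> I. fst p \<noteq> snd p}"

definition collisions :: "('i \<Rightarrow> 's) \<Rightarrow> ('i \<times> 'i) set" where
  "collisions x = {p \<in> pairs. x (fst p) = x (snd p)}"

text \<open>Sets containing both entries of \<open>p\<close> are dropped because restriction to the
  colliding rows may cost them the weight \<open>q\<close> of
  \<open>energy_collision_le\<close>.\<close>

definition block_coeff :: "(nat \<Rightarrow> real) \<Rightarrow> 'i \<times> 'i \<Rightarrow> 'i set \<Rightarrow> real" where
  "block_coeff \<alpha> p S = (if fst p \<in> S \<and> snd p \<in> S then 0 else \<alpha> (card S))"

text \<open>A word colliding at several pairs would be a row in several blocks. These rows are
  merged into one and divided by the root of their number, which Cauchy-Schwarz compensates.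
  Injective words get zero rows.\<close>

definition collision_matrix :: "(nat \<Rightarrow> real) \<Rightarrow> ('i \<Rightarrow> 's) \<Rightarrow> ('i \<Rightarrow> 's) \<Rightarrow> real" where
  "collision_matrix \<alpha> x y = sqrt (q / card (collisions x))
     * (\<Sum>p\<in>collisions x. multiplier (block_coeff \<alpha> p) x y)"

lemma pairsD: "p \<in> pairs \<Longrightarrow> fst p \<in> I \<and> snd p \<in> I \<and> fst p \<noteq> snd p"
  by (auto simp: pairs_def)

lemma finite_pairs: "finite pairs"
  using finite_I by (simp add: pairs_def)

lemma finite_collisions: "finite (collisions x)"
  using finite_pairs by (simp add: collisions_def)

lemma sum_collisions_swap:
  "(\<Sum>x\<in>\<Omega>. \<Sum>p\<in>collisions x. f x p) = (\<Sum>p\<in>pairs. \<Sum>x | x \<in> \<Omega> \<and> x (fst p) = x (snd p). f x p)"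
  unfolding collisions_def by (rule sum.swap_restrict[OF finite_\<Omega> finite_pairs])

section \<open>Upper bound for the masked matrix\<close>

text \<open>Masking compares \<open>S\<close> with the set differing from it only in
  \<open>i\<close>. If neither contains both entries of \<open>p\<close>, consecutive values of
  \<open>\<alpha>\<close> are subtracted; if both do, the result is zero. If exactly one does,
  \<open>p\<close> consists of \<open>i\<close> and an element of \<open>S\<close>, and a full value
  of \<open>\<alpha>\<close> remains, which \<open>H\<close> accounts for.\<close>

lemma hadamard_block_coeff_le:
  assumes p: "p \<in> pairs" and S: "S \<subseteq> I" and i: "i \<in> I"
    and \<delta>: "\<And>k. \<bar>\<alpha> k - \<alpha> (Suc k)\<bar> \<le> \<delta>"
  defines "H \<equiv> (if i \<in> S then (\<alpha> (card S - 1))\<^sup>2 / q else (\<alpha> (card S))\<^sup>2)"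
  shows "(if fst p \<in> S \<and> snd p \<in> S then q else 1) * (hadamard_coeff i (block_coeff \<alpha> p) S)\<^sup>2
    \<le> \<delta>\<^sup>2 + (if fst p = i \<and> snd p \<in> S then H else 0) + (if snd p = i \<and> fst p \<in> S then H else 0)"
proof -
  have fS: "finite S" using S finite_I finite_subset by blast
  have ne: "fst p \<noteq> snd p" using pairsD[OF p] by simp
  have H0: "H \<ge> 0" using q_pos by (simp add: H_def)
  have inv_q: "1 / q \<le> 1" "0 \<le> 1 / q" using q_ge_1 by (simp_all add: divide_le_eq_1)
  have \<delta>sq: "(r * (\<alpha> k - \<alpha> (Suc k)))\<^sup>2 \<le> \<delta>\<^sup>2" if "0 \<le> r" "r \<le> 1" for r k
  proof -
    have "\<bar>r * (\<alpha> k - \<alpha> (Suc k))\<bar> \<le> 1 * \<delta>"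
      unfolding abs_mult using that \<delta>[of k] by (intro mult_mono) auto
    then show ?thesis by (simp add: abs_le_square_iff[symmetric])
  qed
  show ?thesis
  proof (cases "i \<in> S")
    case True
    have cS: "card S = Suc (card (S - {i}))" using True fS by (metis card_Suc_Diff1)
    show ?thesis
    proof (cases "fst p \<in> S \<and> snd p \<in> S")
      case both: True
      show ?thesis
      proof (cases "fst p = i \<or> snd p = i")
        case at_i: True
        \<comment> \<open>Only \<open>S - {i}\<close> keeps its coefficient. It enters divided by
          \<open>q\<close>, so its square times the weight \<open>q\<close> still carries a factor
          \<open>1 / q\<close>.\<close>
        have "block_coeff \<alpha> p S = 0" "block_coeff \<alpha> p (S - {i}) = \<alpha> (card (S - {i}))"
          unfolding block_coeff_def using both at_i by auto
        then have "hadamard_coeff i (block_coeff \<alpha> p) S = - \<alpha> (card (S - {i})) / q"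
          unfolding hadamard_coeff_def using True by simp
        then have "q * (hadamard_coeff i (block_coeff \<alpha> p) S)\<^sup>2 = H"
          unfolding H_def using True q_pos by (simp add: power2_eq_square)
        then show ?thesis using both at_i ne H0 by (auto simp: add_nonneg_nonneg)
      next
        case False
        have "block_coeff \<alpha> p S = 0" "block_coeff \<alpha> p (S - {i}) = 0"
          unfolding block_coeff_def using both False by auto
        then have "hadamard_coeff i (block_coeff \<alpha> p) S = 0"
          unfolding hadamard_coeff_def using True by simp
        then show ?thesis using False by simp
      qed
    next
      case False
      have "block_coeff \<alpha> p S = \<alpha> (Suc (card (S - {i})))" "block_coeff \<alpha> p (S - {i}) = \<alpha> (card (S - {i}))"
        unfolding block_coeff_def cS[symmetric] using False by auto
      then have "hadamard_coeff i (block_coeff \<alpha> p) S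
          = - ((1 / q) * (\<alpha> (card (S - {i})) - \<alpha> (Suc (card (S - {i})))))"
        unfolding hadamard_coeff_def using True by (simp add: diff_divide_distrib)
      then have "(hadamard_coeff i (block_coeff \<alpha> p) S)\<^sup>2 \<le> \<delta>\<^sup>2"
        using \<delta>sq[OF inv_q(2,1), of "card (S - {i})"] by (simp only: power2_minus)
      then show ?thesis using False H0 by (simp only: if_False mult_1) (simp add: add_increasing2)
    qed
  next
    case False
    have cS: "card (insert i S) = Suc (card S)" using False fS by simp
    show ?thesis
    proof (cases "fst p \<in> S \<and> snd p \<in> S")
      case True
      then have "hadamard_coeff i (block_coeff \<alpha> p) S = 0"
        using False by (simp add: hadamard_coeff_def block_coeff_def)
      then show ?thesis using H0 by (simp add: add_nonneg_nonneg)
    next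
      case nboth: False
      show ?thesis
      proof (cases "(fst p = i \<and> snd p \<in> S) \<or> (snd p = i \<and> fst p \<in> S)")
        case True
        \<comment> \<open>Inserting \<open>i\<close> completes the pair, so the larger set has
          coefficient zero and nothing cancels \<open>\<alpha> (card S)\<close>.\<close>
        have "block_coeff \<alpha> p S = \<alpha> (card S)" "block_coeff \<alpha> p (insert i S) = 0"
          unfolding block_coeff_def using nboth True by auto
        then have "hadamard_coeff i (block_coeff \<alpha> p) S = (1 - 1 / q) * \<alpha> (card S)"
          unfolding hadamard_coeff_def using False by simp
        then have "(hadamard_coeff i (block_coeff \<alpha> p) S)\<^sup>2 = (1 - 1 / q)\<^sup>2 * (\<alpha> (card S))\<^sup>2"
          by (simp add: power_mult_distrib)
        also have "\<dots> \<le> 1 * (\<alpha> (card S))\<^sup>2"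
          using inv_q by (intro mult_right_mono) (auto simp: abs_square_le_1)
        finally have "(hadamard_coeff i (block_coeff \<alpha> p) S)\<^sup>2 \<le> H" using False by (simp add: H_def)
        then have "(hadamard_coeff i (block_coeff \<alpha> p) S)\<^sup>2 \<le> \<delta>\<^sup>2 + H" by (simp add: add_increasing)
        then show ?thesis using True False nboth by (elim disjE) auto
      next
        case neither: False
        have "block_coeff \<alpha> p S = \<alpha> (card S)" "block_coeff \<alpha> p (insert i S) = \<alpha> (Suc (card S))"
          unfolding block_coeff_def cS using nboth neither ne by auto
        then have "hadamard_coeff i (block_coeff \<alpha> p) S = (1 - 1 / q) * (\<alpha> (card S) - \<alpha> (Suc (card S)))"
          unfolding hadamard_coeff_def using False by simp
        then have "(hadamard_coeff i (block_coeff \<alpha> p) S)\<^sup>2 \<le> \<delta>\<^sup>2"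
          using \<delta>sq[of "1 - 1 / q" "card S"] inv_q by simp
        then show ?thesis using nboth H0 by (auto simp: add_increasing2)
      qed
    qed
  qed
qed

text \<open>Three contributions of at most 1 each: \<open>\<delta>\<close> squared over at most
  \<open>card I * card I\<close> pairs, and \<open>H\<close> over \<open>card S\<close> pairs with
  \<open>i\<close> in first or in second position.\<close>

lemma sum_hadamard_block_coeff_le:
  assumes S: "S \<subseteq> I" and i: "i \<in> I"
    and \<delta>: "\<And>k. \<bar>\<alpha> k - \<alpha> (Suc k)\<bar> \<le> \<delta>" "real (card I) * \<delta> \<le> 1"
    and \<alpha>: "\<And>k. real k * (\<alpha> k)\<^sup>2 \<le> 1" "\<And>k. real (card I) * (\<alpha> k)\<^sup>2 \<le> q"
  shows "(\<Sum>p\<in>pairs. (if fst p \<in> S \<and> snd p \<in> S then q else 1)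
    * (hadamard_coeff i (block_coeff \<alpha> p) S)\<^sup>2) \<le> 3"
proof -
  define H where "H = (if i \<in> S then (\<alpha> (card S - 1))\<^sup>2 / q else (\<alpha> (card S))\<^sup>2)"
  define g where "g p = \<delta>\<^sup>2 + (if fst p = i \<and> snd p \<in> S then H else 0)
    + (if snd p = i \<and> fst p \<in> S then H else 0)" for p
  have H0: "H \<ge> 0" using q_pos by (simp add: H_def)
  have \<delta>0: "\<delta> \<ge> 0" using \<delta>(1)[of 0] by linarith
  have "(\<Sum>p\<in>pairs. (if fst p \<in> S \<and> snd p \<in> S then q else 1)
      * (hadamard_coeff i (block_coeff \<alpha> p) S)\<^sup>2) \<le> (\<Sum>p\<in>pairs. g p)"
    unfolding g_def H_def by (intro sum_mono hadamard_block_coeff_le S i \<delta>(1))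
  also have "\<dots> \<le> (\<Sum>p\<in>I \<times> I. g p)"
    using finite_I H0 by (intro sum_mono2) (auto simp: pairs_def g_def)
  also have "\<dots> = (\<Sum>a\<in>I. \<Sum>b\<in>I. g (a, b))" by (simp add: sum.cartesian_product)
  also have "\<dots> = (real (card I) * \<delta>)\<^sup>2 + (\<Sum>a\<in>I. \<Sum>b\<in>I. if a = i \<and> b \<in> S then H else 0)
      + (\<Sum>a\<in>I. \<Sum>b\<in>I. if b = i \<and> a \<in> S then H else 0)"
    by (simp add: g_def sum.distrib power2_eq_square)
  also have "(\<Sum>a\<in>I. \<Sum>b\<in>I. if b = i \<and> a \<in> S then H else 0)
      = (\<Sum>a\<in>I. \<Sum>b\<in>I. if a = i \<and> b \<in> S then H else 0)"
    by (rule sum.swap)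
  also have "(\<Sum>a\<in>I. \<Sum>b\<in>I. if a = i \<and> b \<in> S then H else 0) = real (card S) * H"
  proof -
    have "(\<Sum>a\<in>I. \<Sum>b\<in>I. if a = i \<and> b \<in> S then H else 0)
        = (\<Sum>a\<in>I. if a = i then \<Sum>b\<in>I. if b \<in> S then H else 0 else 0)"
      by (intro sum.cong) auto
    also have "\<dots> = (\<Sum>b\<in>I. if b \<in> S then H else 0)" using finite_I i by simp
    also have "\<dots> = real (card S) * H"
      using finite_I S by (simp add: sum.If_cases Int_absorb1)
    finally show ?thesis .
  qed
  \<comment> \<open>If \<open>i\<close> lies in \<open>S\<close>, the division by \<open>q\<close>
    in \<open>H\<close> pays for \<open>card S \<le> card I\<close>; otherwise the decay of
    \<open>\<alpha>\<close> does.\<close>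
  also have "real (card S) * H \<le> 1"
  proof (cases "i \<in> S")
    case True
    have "real (card S) * (\<alpha> (card S - 1))\<^sup>2 \<le> real (card I) * (\<alpha> (card S - 1))\<^sup>2"
      using S finite_I by (intro mult_right_mono) (auto intro: card_mono)
    also have "\<dots> \<le> q" by (rule \<alpha>(2))
    finally show ?thesis using True q_pos by (simp add: H_def)
  next
    case False
    then show ?thesis using \<alpha>(1) by (simp add: H_def)
  qed
  also have "(real (card I) * \<delta>)\<^sup>2 \<le> 1"
    using \<delta>(2) \<delta>0 by (simp add: abs_square_le_1)
  finally show ?thesis by simp
qed

text \<open>Masked blocks remain diagonal in the projections, so each projection can be bounded
  separately. The 9 is the 3 of \<open>energy_collision_le\<close> times the 3 of
  \<open>sum_hadamard_block_coeff_le\<close>.\<close>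

lemma collision_matrix_hadamard_le:
  assumes R: "R \<subseteq> \<Omega>" and i: "i \<in> I"
    and \<delta>: "\<And>k. \<bar>\<alpha> k - \<alpha> (Suc k)\<bar> \<le> \<delta>" "real (card I) * \<delta> \<le> 1"
    and \<alpha>: "\<And>k. real k * (\<alpha> k)\<^sup>2 \<le> 1" "\<And>k. real (card I) * (\<alpha> k)\<^sup>2 \<le> q"
  shows "(\<Sum>x\<in>R. (\<Sum>y\<in>\<Omega>. collision_matrix \<alpha> x y * (if x i \<noteq> y i then 1 else 0) * w y)\<^sup>2)
    \<le> 9 * (\<Sum>y\<in>\<Omega>. (w y)\<^sup>2)"
proof -
  define c where "c p = hadamard_coeff i (block_coeff \<alpha> p)" for p
  define h where "h p x = (\<Sum>y\<in>\<Omega>. multiplier (c p) x y * w y)" for p x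
  have eq: "(\<Sum>y\<in>\<Omega>. collision_matrix \<alpha> x y * (if x i \<noteq> y i then 1 else 0) * w y)
      = sqrt (q / card (collisions x)) * (\<Sum>p\<in>collisions x. h p x)" for x
  proof -
    have "collision_matrix \<alpha> x y * (if x i \<noteq> y i then 1 else 0) * w y
        = sqrt (q / card (collisions x)) * (\<Sum>p\<in>collisions x. multiplier (c p) x y * w y)" for y
      unfolding collision_matrix_def c_def multiplier_hadamard[OF i, symmetric]
      by (simp add: sum_distrib_right)
    then show ?thesis unfolding h_def
      by (simp add: sum_distrib_left[symmetric] sum.swap[of _ \<Omega>])
  qed
  \<comment> \<open>Cauchy-Schwarz over the collisions of \<open>x\<close> loses a factor
    \<open>card (collisions x)\<close>, which the normalisation of the row cancels.\<close>
  have "(sqrt (q / card (collisions x)) * (\<Sum>p\<in>collisions x. h p x))\<^sup>2 \<le> q * (\<Sum>p\<in>collisions x. (h p x)\<^sup>2)"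
    for x
  proof (cases "collisions x = {}")
    case False
    then have m: "real (card (collisions x)) > 0" using finite_collisions by (simp add: card_gt_0_iff)
    have "(sqrt (q / card (collisions x)) * (\<Sum>p\<in>collisions x. h p x))\<^sup>2
        = q / card (collisions x) * (\<Sum>p\<in>collisions x. h p x)\<^sup>2"
      by (simp add: power_mult_distrib)
    also have "\<dots> \<le> q / card (collisions x) * ((\<Sum>p\<in>collisions x. (h p x)\<^sup>2) * card (collisions x))"
      using sum_squared_le_sum_of_squares by (intro mult_left_mono) auto
    also have "\<dots> = q * (\<Sum>p\<in>collisions x. (h p x)\<^sup>2)" using m by simp
    finally show ?thesis .
  qed simp
  then have "(\<Sum>x\<in>R. (\<Sum>y\<in>\<Omega>. collision_matrix \<alpha> x y * (if x i \<noteq> y i then 1 else 0) * w y)\<^sup>2)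
      \<le> (\<Sum>x\<in>R. q * (\<Sum>p\<in>collisions x. (h p x)\<^sup>2))"
    unfolding eq by (intro sum_mono)
  also have "\<dots> \<le> (\<Sum>x\<in>\<Omega>. q * (\<Sum>p\<in>collisions x. (h p x)\<^sup>2))"
    using R finite_\<Omega> by (intro sum_mono2) (auto intro!: mult_nonneg_nonneg sum_nonneg)
  also have "\<dots> = (\<Sum>p\<in>pairs. q * energy {x \<in> \<Omega>. x (fst p) = x (snd p)} (multiplier (c p)) w)"
    unfolding sum_distrib_left[symmetric] sum_collisions_swap energy_def h_def ..
  also have "\<dots> \<le> (\<Sum>p\<in>pairs. 3 * (\<Sum>S\<in>Pow I. (if fst p \<in> S \<and> snd p \<in> S then q else 1)
      * (c p S)\<^sup>2 * energy \<Omega> (kern S) w))"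
    using pairsD by (intro sum_mono energy_collision_le) auto
  also have "\<dots> = 3 * (\<Sum>S\<in>Pow I. (\<Sum>p\<in>pairs. (if fst p \<in> S \<and> snd p \<in> S then q else 1)
      * (c p S)\<^sup>2) * energy \<Omega> (kern S) w)"
    unfolding sum_distrib_left[symmetric] sum_distrib_right by (subst sum.swap) simp
  also have "\<dots> \<le> 3 * (\<Sum>S\<in>Pow I. 3 * energy \<Omega> (kern S) w)"
    unfolding c_def using i \<delta> \<alpha>
    by (intro mult_left_mono sum_mono mult_right_mono sum_hadamard_block_coeff_le energy_nonneg) auto
  also have "\<dots> = 9 * (\<Sum>y\<in>\<Omega>. (w y)\<^sup>2)"
    by (simp add: sum_distrib_left[symmetric] parseval)
  finally show ?thesis .
qed

section \<open>Lower bound by test vectors\<close>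

text \<open>Each pair collides on a \<open>1 / q\<close> fraction of the words. The total is the
  squared norm of the row test vector.\<close>

lemma sum_card_collisions: "(\<Sum>x\<in>\<Omega>. real (card (collisions x))) = real (card pairs) * real (card \<Omega>) / q"
proof -
  have "(\<Sum>x\<in>\<Omega>. real (card (collisions x)))
      = (\<Sum>p\<in>pairs. \<Sum>x | x \<in> \<Omega> \<and> x (fst p) = x (snd p). 1)"
    unfolding sum_collisions_swap[symmetric] by simp
  also have "\<dots> = (\<Sum>p\<in>pairs. real (card \<Omega>) / q)"
  proof (intro sum.cong refl)
    fix p assume "p \<in> pairs"
    then have "q * (\<Sum>x | x \<in> \<Omega> \<and> x (fst p) = x (snd p). 1) = (\<Sum>x\<in>\<Omega>. 1 :: real)"
      using pairsD by (intro sum_collision) auto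
    then show "(\<Sum>x | x \<in> \<Omega> \<and> x (fst p) = x (snd p). 1) = real (card \<Omega>) / q"
      using q_pos by (simp add: field_simps)
  qed
  finally show ?thesis by simp
qed

text \<open>The weight cancels the row normalisation, after which every column of every block sums
  to \<open>\<alpha> 0 / q\<close>. This does not depend on the column, so any column set
  \<open>D\<close> may be used.\<close>

lemma sum_collision_matrix:
  assumes D: "D \<subseteq> \<Omega>"
  shows "(\<Sum>x\<in>\<Omega>. sqrt (card (collisions x)) * (\<Sum>y\<in>D. collision_matrix \<alpha> x y))
    = real (card pairs) * real (card D) * \<alpha> 0 / sqrt q"
proof -
  have *: "sqrt (card (collisions x)) * collision_matrix \<alpha> x y
      = sqrt q * (\<Sum>p\<in>collisions x. multiplier (block_coeff \<alpha> p) x y)" for x y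
    using finite_collisions[of x]
    by (cases "collisions x = {}") (simp_all add: collision_matrix_def real_sqrt_divide)
  have "(\<Sum>x\<in>\<Omega>. sqrt (card (collisions x)) * (\<Sum>y\<in>D. collision_matrix \<alpha> x y))
      = (\<Sum>x\<in>\<Omega>. \<Sum>y\<in>D. sqrt q * (\<Sum>p\<in>collisions x. multiplier (block_coeff \<alpha> p) x y))"
    unfolding sum_distrib_left[of "sqrt (card (collisions _))"] * ..
  also have "\<dots> = sqrt q * (\<Sum>y\<in>D. \<Sum>x\<in>\<Omega>. \<Sum>p\<in>collisions x. multiplier (block_coeff \<alpha> p) x y)"
    by (subst sum.swap) (simp add: sum_distrib_left)
  also have "\<dots> = sqrt q * (\<Sum>y\<in>D. \<Sum>p\<in>pairs. \<alpha> 0 / q)"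
  proof (intro arg_cong[where f = "(*) (sqrt q)"] sum.cong refl)
    fix y assume y: "y \<in> D"
    show "(\<Sum>x\<in>\<Omega>. \<Sum>p\<in>collisions x. multiplier (block_coeff \<alpha> p) x y) = (\<Sum>p\<in>pairs. \<alpha> 0 / q)"
      unfolding sum_collisions_swap
    proof (intro sum.cong refl)
      fix p assume p: "p \<in> pairs"
      have "(\<Sum>x | x \<in> \<Omega> \<and> x (fst p) = x (snd p). multiplier (block_coeff \<alpha> p) x y)
          = block_coeff \<alpha> p {} / q"
        using pairsD[OF p] y D by (intro sum_multiplier_collision) (auto simp: block_coeff_def)
      then show "(\<Sum>x | x \<in> \<Omega> \<and> x (fst p) = x (snd p). multiplier (block_coeff \<alpha> p) x y) = \<alpha> 0 / q"
        by (simp add: block_coeff_def)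
    qed
  qed
  also have "\<dots> = real (card pairs) * real (card D) * \<alpha> 0 * (sqrt q / q)" by simp
  also have "sqrt q / q = 1 / sqrt q" using q_pos by (simp add: field_simps)
  finally show ?thesis by simp
qed

lemma collisions_eq_empty_iff: "collisions x = {} \<longleftrightarrow> inj_on x I"
  by (auto simp: collisions_def pairs_def inj_on_def)

lemma card_pairs: "card pairs = card I * (card I - 1)"
proof -
  have "pairs = I \<times> I - (\<lambda>a. (a, a)) ` I" by (auto simp: pairs_def)
  moreover have "card ((\<lambda>a. (a, a)) ` I) = card I" by (intro card_image) (auto simp: inj_on_def)
  moreover have "(\<lambda>a. (a, a)) ` I \<subseteq> I \<times> I" by auto
  ultimately have "card pairs = card I * card I - card I"
    using finite_I by (simp add: card_Diff_subset)
  then show ?thesis by (simp add: diff_mult_distrib2)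
qed

text \<open>Extending \<open>v\<close> by zero from \<open>D\<close> to all words reduces the
  submatrix to the full matrix, whose squared norm is at most 9.\<close>

lemma spectral_norm_hadamard_le:
  assumes R: "R \<subseteq> \<Omega>" and D: "D \<subseteq> \<Omega>" "D \<noteq> {}" and i: "i \<in> I"
    and A: "\<And>x y. x \<in> R \<Longrightarrow> y \<in> D \<Longrightarrow> A x y = collision_matrix \<alpha> x y * (if x i \<noteq> y i then 1 else 0)"
    and \<delta>: "\<And>k. \<bar>\<alpha> k - \<alpha> (Suc k)\<bar> \<le> \<delta>" "real (card I) * \<delta> \<le> 1"
    and \<alpha>: "\<And>k. real k * (\<alpha> k)\<^sup>2 \<le> 1" "\<And>k. real (card I) * (\<alpha> k)\<^sup>2 \<le> q"
  shows "spectral_norm R D A \<le> 3"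
proof (rule spectral_norm_le)
  show "finite D" using D finite_\<Omega> finite_subset by blast
  show "D \<noteq> {}" by fact
  show "(0::real) \<le> 3" by simp
  fix v :: "('i \<Rightarrow> 's) \<Rightarrow> real"
  define w where "w y = (if y \<in> D then v y else 0)" for y
  have eq: "(\<Sum>y\<in>D. A x y * v y)
      = (\<Sum>y\<in>\<Omega>. collision_matrix \<alpha> x y * (if x i \<noteq> y i then 1 else 0) * w y)" if "x \<in> R" for x
    using that D finite_\<Omega> by (intro sum.mono_neutral_cong_left) (auto simp: A w_def)
  have "(\<Sum>x\<in>R. (\<Sum>y\<in>D. A x y * v y)\<^sup>2)
      = (\<Sum>x\<in>R. (\<Sum>y\<in>\<Omega>. collision_matrix \<alpha> x y * (if x i \<noteq> y i then 1 else 0) * w y)\<^sup>2)"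
    by (rule sum.cong[OF refl]) (simp only: eq)
  also have "\<dots> \<le> 9 * (\<Sum>y\<in>\<Omega>. (w y)\<^sup>2)"
    using R i \<delta> \<alpha> by (rule collision_matrix_hadamard_le)
  also have "(\<Sum>y\<in>\<Omega>. (w y)\<^sup>2) = (\<Sum>y\<in>D. (v y)\<^sup>2)"
    using D finite_\<Omega> by (intro sum.mono_neutral_cong_right) (auto simp: w_def)
  finally show "(\<Sum>x\<in>R. (\<Sum>y\<in>D. A x y * v y)\<^sup>2) \<le> 3\<^sup>2 * (\<Sum>y\<in>D. (v y)\<^sup>2)" by simp
qed

text \<open>Testing the matrix on the all-ones vector over \<open>D\<close> and the vector with entries
  \<open>sqrt (card (collisions x))\<close> undoes the normalisation of the rows with several collisions.\<close>

lemma spectral_norm_collision_matrix_ge: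
  assumes R: "R = {x \<in> \<Omega>. \<not> inj_on x I}" and D: "D \<subseteq> \<Omega>" "D \<noteq> {}" and I: "card I \<ge> 2"
    and A: "\<And>x y. x \<in> R \<Longrightarrow> y \<in> D \<Longrightarrow> A x y = collision_matrix \<alpha> x y"
  shows "\<alpha> 0 * sqrt (card pairs) * sqrt (card D) \<le> sqrt (card \<Omega>) * spectral_norm R D A"
proof -
  have fD: "finite D" using D finite_\<Omega> finite_subset by blast
  define u where "u x = sqrt (card (collisions x))" for x
  define N where "N = spectral_norm R D A"
  have N0: "N \<ge> 0" unfolding N_def by (rule bilinear_form_le_spectral_norm(2)[OF fD D(2)])
  \<comment> \<open>The test vector vanishes on injective words, so the sum over all words reduces
    to the rows in \<open>R\<close>.\<close>
  have u0: "u x = 0" if "x \<in> \<Omega>" "x \<notin> R" for x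
    using that collisions_eq_empty_iff[of x] by (simp add: u_def R)
  have "real (card pairs) * real (card D) * \<alpha> 0 / sqrt q
      = (\<Sum>x\<in>\<Omega>. u x * (\<Sum>y\<in>D. collision_matrix \<alpha> x y))"
    unfolding u_def by (rule sum_collision_matrix[OF D(1), symmetric])
  also have "\<dots> = (\<Sum>x\<in>R. u x * (\<Sum>y\<in>D. A x y * 1))"
    using finite_\<Omega> u0 by (intro sum.mono_neutral_cong_right) (auto simp: R A)
  also have "\<dots> \<le> sqrt (\<Sum>x\<in>R. (u x)\<^sup>2) * N * sqrt (\<Sum>y\<in>D. 1\<^sup>2)"
    unfolding N_def by (rule bilinear_form_le_spectral_norm(1)[OF fD D(2)])
  also have "\<dots> \<le> sqrt (real (card pairs) * real (card \<Omega>) / q) * N * sqrt (card D)"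
  proof -
    have "(\<Sum>x\<in>R. (u x)\<^sup>2) \<le> (\<Sum>x\<in>\<Omega>. (u x)\<^sup>2)"
      using finite_\<Omega> by (intro sum_mono2) (auto simp: R)
    also have "\<dots> = real (card pairs) * real (card \<Omega>) / q"
      using sum_card_collisions by (simp add: u_def)
    finally show ?thesis using N0 by (auto intro!: mult_right_mono)
  qed
  finally have "real (card pairs) * real (card D) * \<alpha> 0 / sqrt q
      \<le> sqrt (card pairs) * sqrt (card \<Omega>) / sqrt q * N * sqrt (card D)"
    by (simp add: real_sqrt_mult real_sqrt_divide)
  then have "real (card pairs) * real (card D) * \<alpha> 0
      \<le> sqrt (card pairs) * sqrt (card \<Omega>) * N * sqrt (card D)"
    using q_pos by (simp add: divide_le_cancel)
  \<comment> \<open>Cardinalities are split into square roots to expose a common factor, positive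
    because two positions already form a pair.\<close>
  moreover have "real (card pairs) * real (card D) * \<alpha> 0
      = (sqrt (card pairs) * sqrt (card pairs)) * (sqrt (card D) * sqrt (card D)) * \<alpha> 0"
    by simp
  ultimately have "(sqrt (card pairs) * sqrt (card D)) * (\<alpha> 0 * sqrt (card pairs) * sqrt (card D))
      \<le> (sqrt (card pairs) * sqrt (card D)) * (sqrt (card \<Omega>) * N)"
    by (simp only: mult_ac)
  moreover have "sqrt (card pairs) * sqrt (card D) > 0"
  proof -
    have "card pairs > 0" using I by (simp add: card_pairs)
    moreover have "card D > 0" using fD D(2) by (simp add: card_gt_0_iff)
    ultimately show ?thesis by simp
  qed
  ultimately show ?thesis unfolding N_def by (simp only: mult_le_cancel_left_pos)
qed

end

subsection \<open>Element distinctness\<close>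

text \<open>In the bound \<open>ln (1 - t) \<ge> - t - 2 * t * t\<close>, the condition
  \<open>t \<le> 1/2\<close> absorbs the quadratic term into another \<open>- t\<close>.\<close>

lemma exp_le_one_minus:
  fixes t :: real
  assumes "0 \<le> t" "t \<le> 1/2"
  shows "exp (- 2 * t) \<le> 1 - t"
proof -
  have "- t - 2 * t\<^sup>2 \<le> ln (1 - t)" using assms by (rule ln_one_minus_pos_lower_bound)
  moreover have "t * t \<le> (1/2) * t" using assms by (intro mult_right_mono)
  ultimately have "- 2 * t \<le> ln (1 - t)" by (simp add: power2_eq_square)
  then have "exp (- 2 * t) \<le> exp (ln (1 - t))" by simp
  then show ?thesis using assms by simp
qed

text \<open>The fraction of injective words is the product of \<open>1 - k / q\<close> over
  \<open>k < n\<close>, at least \<open>(1 - n / q) ^ n\<close> and hence at least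
  \<open>exp (- 2 * n * n / q)\<close>; \<open>q \<ge> 2 * n\<close> brings \<open>n / q\<close>
  into the range of \<open>exp_le_one_minus\<close>.\<close>

lemma card_inj_words_ge:
  fixes n q :: nat and c :: real
  assumes c: "c > 0" and q: "real q \<ge> c * (real n)\<^sup>2" "q \<ge> 2 * n" "q > 0"
  shows "exp (- 2 / c) * real (card ({1..n} \<rightarrow>\<^sub>E {1..q}))
    \<le> real (card {x \<in> {1..n} \<rightarrow>\<^sub>E {1..q}. inj_on x {1..n}})"
proof -
  have W: "real (card ({1..n} \<rightarrow>\<^sub>E {1..q})) = real q ^ n" by (simp add: card_funcsetE)
  have "exp (- 2 / c) \<le> exp (- 2 * (real n / real q)) ^ n"
  proof -
    have "real n * (real n / real q) \<le> 1 / c"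
      using c q by (simp add: power2_eq_square field_simps)
    moreover have "real n * (- 2 * (real n / real q)) = - 2 * (real n * (real n / real q))"
      by (rule mult.left_commute)
    ultimately have "- 2 / c \<le> real n * (- 2 * (real n / real q))" by linarith
    then show ?thesis unfolding exp_of_nat_mult[symmetric] by simp
  qed
  also have "\<dots> \<le> (1 - real n / real q) ^ n"
    using q by (intro power_mono exp_le_one_minus) (simp_all add: field_simps)
  finally have "exp (- 2 / c) * real q ^ n \<le> (1 - real n / real q) ^ n * real q ^ n"
    by (intro mult_right_mono) auto
  also have "\<dots> = (\<Prod>k\<in>{0..<n}. real (q - n))"
    using q by (simp add: power_mult_distrib[symmetric] left_diff_distrib of_nat_diff)
  also have "\<dots> \<le> (\<Prod>k\<in>{0..<n}. real (q - k))"
    by (intro prod_mono) auto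
  also have "\<dots> = real (card {x \<in> {1..n} \<rightarrow>\<^sub>E {1..q}. inj_on x {1..n}})"
    using card_inj_on_subset_funcset[of "{1..n}" "{1..q}" "{1..n}"] by simp
  finally show ?thesis unfolding W .
qed

theorem theorem2:
  shows "\<forall>c::real. c > 0 \<longrightarrow>
    (\<exists>C::real. C > 0 \<and>
      (\<exists>n0::nat. \<forall>n q::nat. n \<ge> n0 \<longrightarrow> real q \<ge> c * (real n)\<^sup>2 \<longrightarrow>
        (\<exists>\<Gamma> \<in> adversary_matrices (strings n q) (element_distinctness n).
          adversary_norm (strings n q) (element_distinctness n) \<Gamma> /
          Max ((\<lambda>i. adversary_norm (strings n q) (element_distinctness n)
                 (hadamard \<Gamma> (Delta (strings n q) (element_distinctness n) i))) ` {1..n})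
          \<ge> C * real n powr (2/3))))"
proof (intro allI impI)
  fix c :: real assume c: "c > 0"
  \<comment> \<open>From \<open>n \<ge> 2 / c\<close> follows \<open>c * n * n \<ge> 2 * n\<close>,
    hence \<open>q \<ge> 2 * n\<close>; the summand 2 ensures that a pair of positions
    exists.\<close>
  define n0 where "n0 = nat \<lceil>2 / c\<rceil> + 2"
  show "\<exists>C::real. C > 0 \<and>
      (\<exists>n0::nat. \<forall>n q::nat. n \<ge> n0 \<longrightarrow> real q \<ge> c * (real n)\<^sup>2 \<longrightarrow>
        (\<exists>\<Gamma> \<in> adversary_matrices (strings n q) (element_distinctness n).
          adversary_norm (strings n q) (element_distinctness n) \<Gamma> /
          Max ((\<lambda>i. adversary_norm (strings n q) (element_distinctness n)
                 (hadamard \<Gamma> (Delta (strings n q) (element_distinctness n) i))) ` {1..n})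
          \<ge> C * real n powr (2/3)))"
  \<comment> \<open>\<open>exp (- 1 / c)\<close> is the root of the guaranteed fraction of injective
    words, 1/2 comes from \<open>sqrt (card pairs) \<ge> n / 2\<close>, and 1/3 from the masked
    norms.\<close>
  proof (rule exI[of _ "exp (- 1 / c) / 6"], intro conjI exI[of _ n0] allI impI)
    show "0 < exp (- 1 / c) / 6" by simp
    fix n q :: nat
    assume n: "n0 \<le> n" and q: "c * (real n)\<^sup>2 \<le> real q"
    have n2: "n \<ge> 2" using n by (simp add: n0_def)
    have "real n \<ge> 2 / c" using n unfolding n0_def by linarith
    then have "2 * real n \<le> (c * real n) * real n"
      using c by (intro mult_right_mono) (simp_all add: field_simps)
    then have "2 * real n \<le> real q" using q by (simp add: power2_eq_square mult_ac)
    then have qn: "q \<ge> 2 * n" by linarith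
    have qpos: "q > 0" using qn n2 by simp
    interpret word_space "{1..n}" "{1..q}"
      by unfold_locales (use qpos in auto)
    define R where "R = fiber (strings n q) (element_distinctness n) 1"
    define D where "D = fiber (strings n q) (element_distinctness n) 0"
    have R_eq: "R = {x \<in> {1..n} \<rightarrow>\<^sub>E {1..q}. \<not> inj_on x {1..n}}"
      and D_eq: "D = {x \<in> {1..n} \<rightarrow>\<^sub>E {1..q}. inj_on x {1..n}}"
      by (auto simp: R_def D_def fiber_def strings_def element_distinctness_def split: if_splits)
    have RD: "R \<subseteq> {1..n} \<rightarrow>\<^sub>E {1..q}" "D \<subseteq> {1..n} \<rightarrow>\<^sub>E {1..q}" by (auto simp: R_eq D_eq)
    have fin: "finite R" "finite D" using RD finite_\<Omega> finite_subset by blast+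
    define W where "W = real (card ({1..n} \<rightarrow>\<^sub>E {1..q}))"
    have W: "W > 0" using qpos by (simp add: W_def card_funcsetE)
    have DW: "exp (- 2 / c) * W \<le> real (card D)"
      unfolding W_def D_eq by (rule card_inj_words_ge[OF c q qn qpos])
    have "0 < exp (- 2 / c) * W" using W by simp
    with DW have "card D > 0" by linarith
    then have D_ne: "D \<noteq> {}" by auto
    \<comment> \<open>\<open>\<alpha>\<close> falls from \<open>r\<close> with slope
      \<open>1 / n\<close>, the steepest that \<open>\<delta>\<close> allows, and vanishes for
      \<open>k \<ge> n * r\<close>. So \<open>k * (\<alpha> k)\<^sup>2\<close> is at most
      \<open>n * r * r\<^sup>2\<close>, and the exponent \<open>- 1 / 3\<close> makes this
      1.\<close>
    define r where "r = real n powr (- 1 / 3)"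
    define \<alpha> where "\<alpha> k = max 0 (r - real k / real n)" for k :: nat
    have r0: "r > 0" using n2 by (simp add: r_def)
    have r1: "r \<le> 1" unfolding r_def using n2 powr_mono[of "- 1 / 3" 0 "real n"] by simp
    have r3: "real n * r * r\<^sup>2 = 1"
    proof -
      have "r * r * r = real n powr (- 1 / 3 + - 1 / 3 + - 1 / 3)"
        unfolding r_def powr_add ..
      then have "r * r * r = 1 / real n" using n2 by (simp add: powr_minus_divide)
      then show ?thesis using n2 by (simp add: power2_eq_square mult.assoc)
    qed
    have nr: "real n * r = real n powr (2/3)"
      using n2 powr_add[of "real n" 1 "- 1 / 3"] by (simp add: r_def)
    have \<alpha>r: "0 \<le> \<alpha> k" "\<alpha> k \<le> r" for k using r0 by (auto simp: \<alpha>_def)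
    then have \<alpha>r2: "(\<alpha> k)\<^sup>2 \<le> r\<^sup>2" for k by (simp add: power_mono)
    have \<delta>: "\<bar>\<alpha> k - \<alpha> (Suc k)\<bar> \<le> 1 / real n" for k
    proof -
      have "real (Suc k) / real n = real k / real n + 1 / real n" by (simp add: add_divide_distrib)
      moreover have "1 / real n \<ge> 0" by simp
      ultimately show ?thesis unfolding \<alpha>_def by linarith
    qed
    have k\<alpha>: "real k * (\<alpha> k)\<^sup>2 \<le> 1" for k
    proof (cases "\<alpha> k = 0")
      case False
      then have "real k / real n \<le> r" by (auto simp: \<alpha>_def max_def split: if_splits)
      then have "real k \<le> real n * r" using n2 by (simp add: field_simps)
      then have "real k * (\<alpha> k)\<^sup>2 \<le> (real n * r) * r\<^sup>2"
        using \<alpha>r2 r0 by (intro mult_mono) auto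
      then show ?thesis using r3 by simp
    qed simp
    have n\<alpha>: "real n * (\<alpha> k)\<^sup>2 \<le> real q" for k
    proof -
      have "(\<alpha> k)\<^sup>2 \<le> 1" using \<alpha>r[of k] r1 by (simp add: abs_square_le_1)
      then have "real n * (\<alpha> k)\<^sup>2 \<le> real n" by (simp add: mult_left_le)
      then show ?thesis using qn by linarith
    qed
    define \<Gamma> where "\<Gamma> x y = (if x \<in> R \<and> y \<in> D then collision_matrix \<alpha> x y else 0)" for x y
    define N where "N = spectral_norm R D \<Gamma>"
    have lower: "exp (- 1 / c) / 2 * real n powr (2/3) \<le> N"
    proof -
      have "real n / 2 \<le> sqrt (card pairs)"
      proof (rule real_le_rsqrt)
        have "n * n \<le> 4 * (n * (n - 1))" using n2 by simp
        then have "real (n * n) \<le> real (4 * (n * (n - 1)))" by (rule of_nat_mono)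
        then show "(real n / 2)\<^sup>2 \<le> real (card pairs)"
          unfolding card_pairs by (simp add: power2_eq_square)
      qed
      moreover have "exp (- 1 / c) * sqrt W \<le> sqrt (card D)"
      proof (rule real_le_rsqrt)
        have "(exp (- 1 / c))\<^sup>2 = exp (- 2 / c)"
          by (simp add: power2_eq_square exp_add[symmetric])
        then show "(exp (- 1 / c) * sqrt W)\<^sup>2 \<le> real (card D)"
          using DW W by (simp add: power_mult_distrib)
      qed
      ultimately have "(r * (real n / 2)) * (exp (- 1 / c) * sqrt W)
          \<le> (\<alpha> 0 * sqrt (card pairs)) * sqrt (card D)"
        using r0 W by (intro mult_mono) (auto simp: \<alpha>_def)
      also have "\<dots> \<le> sqrt W * N"
        unfolding W_def N_def
        by (rule spectral_norm_collision_matrix_ge[OF R_eq RD(2) D_ne]) (use n2 in \<open>simp_all add: \<Gamma>_def\<close>)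
      finally have "sqrt W * (exp (- 1 / c) / 2 * (real n * r)) \<le> sqrt W * N"
        by (simp add: mult_ac)
      then show ?thesis using W nr by simp
    qed
    define M where "M i = spectral_norm R D
        (hadamard \<Gamma> (Delta (strings n q) (element_distinctness n) i))" for i
    have ent: "hadamard \<Gamma> (Delta (strings n q) (element_distinctness n) i) x y
        = collision_matrix \<alpha> x y * (if x i \<noteq> y i then 1 else 0)" if "x \<in> R" "y \<in> D" for x y i
      unfolding hadamard_def \<Gamma>_def Delta_def R_def[symmetric] D_def[symmetric] using that by simp
    have upper: "M i \<le> 3" if "i \<in> {1..n}" for i
      unfolding M_def
      by (rule spectral_norm_hadamard_le[OF RD D_ne that, where \<alpha> = \<alpha> and \<delta> = "1 / real n"])
        (use ent \<delta> k\<alpha> n\<alpha> n2 in simp_all)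
    \<comment> \<open>A non-zero entry is needed twice: for membership in the adversary matrices,
      and to make the denominator positive, since division by zero would give 0.\<close>
    have "\<exists>x\<in>R. \<exists>y\<in>D. \<Gamma> x y \<noteq> 0"
    proof (rule ccontr)
      assume "\<not> ?thesis"
      then have "(\<Sum>x\<in>R. (\<Sum>y\<in>D. \<Gamma> x y * v y)\<^sup>2) \<le> 0\<^sup>2 * (\<Sum>y\<in>D. (v y)\<^sup>2)" for v by simp
      then have "N \<le> 0" unfolding N_def by (intro spectral_norm_le[OF fin(2) D_ne]) auto
      moreover have "exp (- 1 / c) / 2 * real n powr (2/3) > 0" using n2 by simp
      ultimately show False using lower by linarith
    qed
    then obtain x y where xy: "x \<in> R" "y \<in> D" "\<Gamma> x y \<noteq> 0" by blast
    \<comment> \<open>One word is injective and the other is not, so they differ at some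
      \<open>i\<close>, and the mask at \<open>i\<close> keeps the non-zero entry.\<close>
    then have "x \<noteq> y" by (auto simp: R_eq D_eq)
    then obtain i where i: "i \<in> {1..n}" "x i \<noteq> y i"
      using PiE_ext[OF subsetD[OF RD(1) xy(1)] subsetD[OF RD(2) xy(2)]] by blast
    have "M i > 0"
      unfolding M_def using fin xy(1,2)
    proof (rule spectral_norm_pos)
      have "collision_matrix \<alpha> x y = \<Gamma> x y" using xy by (simp add: \<Gamma>_def)
      then show "hadamard \<Gamma> (Delta (strings n q) (element_distinctness n) i) x y \<noteq> 0"
        unfolding ent[OF xy(1,2)] using xy(3) i(2) by simp
    qed
    moreover have "M i \<le> Max (M ` {1..n})" using i(1) by (intro Max_ge) auto
    ultimately have Mpos: "Max (M ` {1..n}) > 0" by linarith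
    have Mle: "Max (M ` {1..n}) \<le> 3" using upper n2 by simp
    have "\<Gamma> \<in> adversary_matrices (strings n q) (element_distinctness n)"
      using xy unfolding adversary_matrices_def matrices_def R_def[symmetric] D_def[symmetric]
      by (auto simp: \<Gamma>_def fun_eq_iff)
    moreover have "exp (- 1 / c) / 6 * real n powr (2/3) \<le> N / Max (M ` {1..n})"
    proof -
      have "exp (- 1 / c) / 6 * real n powr (2/3) \<le> N / 3" using lower by simp
      also have "\<dots> \<le> N / Max (M ` {1..n})"
        using Mpos Mle bilinear_form_le_spectral_norm(2)[OF fin(2) D_ne, of R \<Gamma>]
        by (intro divide_left_mono) (auto simp: N_def)
      finally show ?thesis .
    qed
    ultimately show "\<exists>\<Gamma> \<in> adversary_matrices (strings n q) (element_distinctness n).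
          adversary_norm (strings n q) (element_distinctness n) \<Gamma> /
          Max ((\<lambda>i. adversary_norm (strings n q) (element_distinctness n)
                 (hadamard \<Gamma> (Delta (strings n q) (element_distinctness n) i))) ` {1..n})
          \<ge> exp (- 1 / c) / 6 * real n powr (2/3)"
      unfolding adversary_norm_def R_def[symmetric] D_def[symmetric] N_def M_def by blast
  qed
qed

end
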